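(* Let $D$ be a domain in $\mathbb{R}^N$, $N\geq 2$. Then the following statements are equivalent for every function $u: D\to[-\infty,\infty)$. (1) The function $u$ is harmonic in $D$. (2) There is $K\geq 1$ such that the functions $u$ and $-u$ are both $K$-quasinearly subharmonic n.s. in $D$.
   Context: $B^N(x,r)$ is the open ball in $\mathbb{R}^N$ with center $x$ and radius $r>0$, $\overline{B^N(x,r)}$ its closure, $m_N$ is Lebesgue measure on $\mathbb{R}^N$, $\nu_N$ is the volume of the unit ball of $\mathbb{R}^N$, and $u^+=\max\{u,0\}$. For $K\geq 1$, a function $u: D\to[-\infty,+\infty)$ is called $K$-quasinearly subharmonic n.s. (in the narrow sense) in $D$ if $u$ is Lebesgue measurable, $u^+\in\mathcal{L}^1_{\mathrm{loc}}(D)$, and $$u(x)\leq \frac{K}{\nu_N r^N}\int_{B^N(x,r)}u(y)\,dm_N(y)$$ for all closed balls $\overline{B^N(x,r)}\subset D$ (the integral may equal $-\infty$). In particular, for $-u$ to be $K$-quasinearly subharmonic n.s. it must take values in $[-\infty,+\infty)$, i.e. $u$ never takes the value $-\infty$. *)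

theory Defs
  imports "HOL-Analysis.Analysis"
begin

section \<open>Harmonic functions\<close>

text \<open>On an open set \<open>D\<close> the derivatives below depend only on the values of \<open>f\<close> in \<open>D\<close>.\<close>

definition partial_deriv :: "'a::euclidean_space \<Rightarrow> ('a \<Rightarrow> real) \<Rightarrow> 'a \<Rightarrow> real" where
  "partial_deriv b f x = deriv (\<lambda>t. f (x + t *\<^sub>R b)) 0"

definition C1_fun_on :: "'a::euclidean_space set \<Rightarrow> ('a \<Rightarrow> real) \<Rightarrow> bool" where
  "C1_fun_on D f \<longleftrightarrow>
     (\<forall>b\<in>Basis. (\<forall>x\<in>D. (\<lambda>t. f (x + t *\<^sub>R b)) differentiable at 0) \<and>
                continuous_on D (partial_deriv b f))"

definition C2_fun_on :: "'a::euclidean_space set \<Rightarrow> ('a \<Rightarrow> real) \<Rightarrow> bool" where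
  "C2_fun_on D f \<longleftrightarrow> C1_fun_on D f \<and> (\<forall>b\<in>Basis. C1_fun_on D (partial_deriv b f))"

definition laplacian :: "('a::euclidean_space \<Rightarrow> real) \<Rightarrow> 'a \<Rightarrow> real" where
  "laplacian f x = (\<Sum>b\<in>Basis. partial_deriv b (partial_deriv b f) x)"

definition harmonic_fun_on :: "'a::euclidean_space set \<Rightarrow> ('a \<Rightarrow> real) \<Rightarrow> bool" where
  "harmonic_fun_on D f \<longleftrightarrow> C2_fun_on D f \<and> (\<forall>x\<in>D. laplacian f x = 0)"

text \<open>An extended-real-valued function is harmonic if it is finite and harmonic as a real function.\<close>

definition harmonic_ereal_on :: "'a::euclidean_space set \<Rightarrow> ('a \<Rightarrow> ereal) \<Rightarrow> bool" where
  "harmonic_ereal_on D u \<longleftrightarrow>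
     (\<forall>x\<in>D. \<bar>u x\<bar> \<noteq> \<infinity>) \<and> harmonic_fun_on D (\<lambda>x. real_of_ereal (u x))"

section \<open>Quasinearly subharmonic functions in the narrow sense\<close>

text \<open>The integral of the positive part minus that of the negative part
  (\<open>e2ennreal\<close> sends negative numbers to 0). It is meaningful only if one of the two is finite;
  it is \<open>-\<infinity>\<close> if only the second one is infinite.\<close>

definition ereal_integral :: "'a measure \<Rightarrow> ('a \<Rightarrow> ereal) \<Rightarrow> ereal" where
  "ereal_integral M f =
     enn2ereal (\<integral>\<^sup>+x. e2ennreal (f x) \<partial>M) - enn2ereal (\<integral>\<^sup>+x. e2ennreal (- f x) \<partial>M)"

definition locally_integrable_on :: "('a::euclidean_space \<Rightarrow> ereal) \<Rightarrow> 'a set \<Rightarrow> bool" where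
  "locally_integrable_on f D \<longleftrightarrow>
     f \<in> borel_measurable (lebesgue_on D) \<and>
     (\<forall>C. compact C \<and> C \<subseteq> D \<longrightarrow> (\<integral>\<^sup>+x. e2ennreal \<bar>f x\<bar> \<partial>lebesgue_on C) < \<infinity>)"

definition quasinearly_subharmonic_ns ::
    "real \<Rightarrow> 'a::euclidean_space set \<Rightarrow> ('a \<Rightarrow> ereal) \<Rightarrow> bool" where
  "quasinearly_subharmonic_ns K D u \<longleftrightarrow>
     (\<forall>x\<in>D. u x < \<infinity>) \<and>
     u \<in> borel_measurable (lebesgue_on D) \<and>
     locally_integrable_on (\<lambda>x. max (u x) 0) D \<and>
     (\<forall>x r. 0 < r \<and> cball x r \<subseteq> D \<longrightarrow>
        u x \<le> ereal (K / (measure lebesgue (ball (0::'a) 1) * r ^ DIM('a))) *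
              ereal_integral (lebesgue_on (ball x r)) u)"

end

theory Submission
  imports Defs
begin

text \<open>If \<open>u\<close> and \<open>-u\<close> are both \<open>K\<close>-quasinearly subharmonic n.s., then both inequalities are
  equalities: \<open>u x\<close> is \<open>K\<close> times the mean of \<open>u\<close> over every ball. Averaging over the radius, the same
  holds for all radial kernels, so \<open>u\<close> is locally a convolution with a radial \<open>C\<^sup>2\<close> kernel, and its
  Laplacian is \<open>u\<close> times the integral of the Laplacian of the kernel, which is zero.
  Conversely, for harmonic \<open>u\<close> the mean over the ball of radius \<open>t\<close> has derivative zero in \<open>t\<close>.
  Surface integrals are avoided by integrating by parts against compactly supported kernels,
  which only uses the translation invariance of Lebesgue measure.\<close>

section \<open>Differentiation under the integral sign\<close>

text \<open>One family of kernels, the truncated powers \<open>(c - |z|^2)^p\<close>, serves both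
  directions. Exponent 0 is the indicator of a ball, about which the hypothesis speaks. A derivative
  in c lowers the exponent, so identities for balls climb to smooth kernels; the Laplacian in z is
  again a combination of members of the family, so the mean value identity can evaluate it. Exponent
  4 is used to represent u, exponent 1 for the converse because its gradient on the ball is a
  multiple of z. Exponent 1 has a corner on the sphere, which is why the analytic lemmas ask for a
  derivative almost everywhere together with a Lipschitz bound. At the start u is merely Lebesgue
  measurable and locally integrable. What rescues regularity is that the identity with the ball
  averages holds at every point, so the convolution is u itself and not just a version of it. The
  value of K is never determined: the identity is linear, and the factor K is moved into the
  function that is averaged.\<close>

lemma has_real_derivative_integral_dominated:
  fixes f :: "real \<Rightarrow> 'b \<Rightarrow> real"
  assumes d: "0 < d"
    and int: "\<And>t. \<bar>t - a\<bar> < d \<Longrightarrow> integrable M (f t)"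
    and der: "AE y in M. ((\<lambda>t. f t y) has_real_derivative f' y) (at a)"
    and lip: "\<And>t. \<bar>t - a\<bar> < d \<Longrightarrow> AE y in M. \<bar>f t y - f a y\<bar> \<le> L y * \<bar>t - a\<bar>"
    and L: "integrable M L"
    and f': "f' \<in> borel_measurable M"
  shows "((\<lambda>t. \<integral>y. f t y \<partial>M) has_real_derivative (\<integral>y. f' y \<partial>M)) (at a)"
  unfolding has_field_derivative_iff tendsto_at_iff_sequentially
proof (intro allI impI)
  fix X :: "nat \<Rightarrow> real"
  assume X: "\<forall>i. X i \<in> UNIV - {a}" "X \<longlonglongrightarrow> a"
  have "eventually (\<lambda>n. dist (X n) a < d) sequentially"
    using X(2) d by (rule tendstoD)
  then obtain N where N: "\<And>n. n \<ge> N \<Longrightarrow> \<bar>X n - a\<bar> < d"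
    by (auto simp: eventually_sequentially dist_real_def)
  \<comment> \<open>The hypotheses hold only within distance d of a, so the sequence is entered at
    index N; from there on L dominates every difference quotient.\<close>
  define q where "q n y = (f (X (n + N)) y - f a y) / (X (n + N) - a)" for n y
  have inta: "integrable M (f a)" using int[of a] d by simp
  have intX: "integrable M (f (X (n + N)))" for n using int N by simp
  have "(\<lambda>n. \<integral>y. q n y \<partial>M) \<longlonglongrightarrow> (\<integral>y. f' y \<partial>M)"
  proof (rule integral_dominated_convergence[where w = L])
    show "q n \<in> borel_measurable M" for n
      unfolding q_def using intX[of n] inta by (auto dest!: borel_measurable_integrable)
    show "AE y in M. (\<lambda>n. q n y) \<longlonglongrightarrow> f' y"
      using der
    proof eventually_elim
      case (elim y)
      then have "((\<lambda>t. (f t y - f a y) / (t - a)) \<longlongrightarrow> f' y) (at a)"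
        by (simp add: has_field_derivative_iff)
      then have "((\<lambda>t. (f t y - f a y) / (t - a)) \<circ> X) \<longlonglongrightarrow> f' y"
        using X unfolding tendsto_at_iff_sequentially by blast
      then show ?case
        unfolding q_def comp_def by (rule LIMSEQ_ignore_initial_segment)
    qed
    show "AE y in M. norm (q n y) \<le> L y" for n
      using lip[OF N[OF le_add2[of N n]]]
    proof eventually_elim
      case (elim y)
      have "0 < \<bar>X (n + N) - a\<bar>" using X(1) by auto
      then show ?case using elim by (simp add: q_def abs_divide divide_le_eq mult.commute)
    qed
  qed (use L f' in auto)
  moreover have "(\<integral>y. q n y \<partial>M) = ((\<integral>y. f (X (n + N)) y \<partial>M) - (\<integral>y. f a y \<partial>M)) / (X (n + N) - a)" for n
    unfolding q_def using intX inta by simp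
  ultimately have "(\<lambda>n. ((\<integral>y. f (X (n + N)) y \<partial>M) - (\<integral>y. f a y \<partial>M)) / (X (n + N) - a)) \<longlonglongrightarrow> (\<integral>y. f' y \<partial>M)"
    by simp
  then show "((\<lambda>t. ((\<integral>y. f t y \<partial>M) - (\<integral>y. f a y \<partial>M)) / (t - a)) \<circ> X) \<longlonglongrightarrow> (\<integral>y. f' y \<partial>M)"
    unfolding comp_def by (rule LIMSEQ_offset)
qed

lemma continuous_on_integral_bounded_kernel:
  fixes k :: "'a::metric_space \<Rightarrow> 'b \<Rightarrow> real"
  assumes meas: "\<And>x. x \<in> S \<Longrightarrow> k x \<in> borel_measurable M"
    and bd: "\<And>x y. x \<in> S \<Longrightarrow> \<bar>k x y\<bar> \<le> w y"
    and cont: "\<And>y. continuous_on S (\<lambda>x. k x y)"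
    and w: "integrable M w"
  shows "continuous_on S (\<lambda>x. \<integral>y. k x y \<partial>M)"
  unfolding continuous_on_sequentially
proof (intro allI ballI impI)
  fix X a assume a: "a \<in> S" and X: "(\<forall>n. X n \<in> S) \<and> X \<longlonglongrightarrow> a"
  have "(\<lambda>n. \<integral>y. k (X n) y \<partial>M) \<longlonglongrightarrow> (\<integral>y. k a y \<partial>M)"
  proof (rule integral_dominated_convergence[where w = w])
    show "AE y in M. (\<lambda>n. k (X n) y) \<longlonglongrightarrow> k a y"
    proof (rule AE_I2)
      fix y
      show "(\<lambda>n. k (X n) y) \<longlonglongrightarrow> k a y"
        using cont[of y] a X unfolding continuous_on_sequentially comp_def by blast
    qed
  qed (use meas bd w a X in auto)
  then show "((\<lambda>x. \<integral>y. k x y \<partial>M) \<circ> X) \<longlonglongrightarrow> (\<integral>y. k a y \<partial>M)"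
    by (simp add: comp_def)
qed

lemma integrable_bounded_mult:
  fixes k w :: "'b \<Rightarrow> real"
  assumes k: "k \<in> borel_measurable M" and bd: "\<And>y. \<bar>k y\<bar> \<le> B" and w: "integrable M w"
  shows "integrable M (\<lambda>y. k y * w y)"
proof (rule Bochner_Integration.integrable_bound[where f = "\<lambda>y. B * w y"])
  show "AE y in M. norm (k y * w y) \<le> norm (B * w y)"
  proof (rule AE_I2)
    fix y
    have "\<bar>k y\<bar> \<le> \<bar>B\<bar>" using bd[of y] by linarith
    then show "norm (k y * w y) \<le> norm (B * w y)" by (simp add: abs_mult mult_right_mono)
  qed
qed (use k w in auto)

section \<open>Estimates along lines and integration by parts\<close>

lemma has_real_derivative_line_shift:
  fixes v :: "'a::real_vector \<Rightarrow> real"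
  assumes "((\<lambda>s. v (y + t *\<^sub>R b + s *\<^sub>R b)) has_real_derivative D) (at 0)"
  shows "((\<lambda>s. v (y + s *\<^sub>R b)) has_real_derivative D) (at t)"
proof -
  have "((\<lambda>s. v (y + (s + t) *\<^sub>R b)) has_real_derivative D) (at 0)"
    using assms by (simp add: algebra_simps)
  then show ?thesis using DERIV_shift[of "\<lambda>s. v (y + s *\<^sub>R b)" D 0 t] by simp
qed

lemma line_lipschitz:
  fixes v :: "'a::real_vector \<Rightarrow> real"
  assumes der: "\<And>t. \<bar>t\<bar> \<le> \<bar>h\<bar> \<Longrightarrow> ((\<lambda>s. v (y + t *\<^sub>R b + s *\<^sub>R b)) has_real_derivative v' (y + t *\<^sub>R b)) (at 0)"
    and bd: "\<And>t. \<bar>t\<bar> \<le> \<bar>h\<bar> \<Longrightarrow> \<bar>v' (y + t *\<^sub>R b)\<bar> \<le> L"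
  shows "\<bar>v (y + h *\<^sub>R b) - v y\<bar> \<le> L * \<bar>h\<bar>"
proof -
  have "norm (v (y + h *\<^sub>R b) - v (y + 0 *\<^sub>R b)) \<le> L * norm (h - 0)"
  proof (rule field_differentiable_bound[where S = "{-\<bar>h\<bar>..\<bar>h\<bar>}"])
    fix t :: real assume "t \<in> {- \<bar>h\<bar>..\<bar>h\<bar>}"
    then have t: "\<bar>t\<bar> \<le> \<bar>h\<bar>" by auto
    show "((\<lambda>t. v (y + t *\<^sub>R b)) has_real_derivative v' (y + t *\<^sub>R b)) (at t within {- \<bar>h\<bar>..\<bar>h\<bar>})"
      using has_real_derivative_line_shift[OF der[OF t]] by (rule has_field_derivative_at_within)
    show "norm (v' (y + t *\<^sub>R b)) \<le> L" using bd[OF t] by simp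
  qed auto
  then show ?thesis by simp
qed

text \<open>The kernel carries all the regularity, w is merely integrable. This is the common source
  of integration by parts and of the derivatives of convolutions.\<close>

lemma has_real_derivative_integral_shifted_kernel:
  fixes k w :: "'a::euclidean_space \<Rightarrow> real"
  assumes k: "k \<in> borel_measurable borel" "\<And>y. \<bar>k y\<bar> \<le> B"
    and lip: "\<And>y h. \<bar>k (y + h *\<^sub>R b) - k y\<bar> \<le> L * \<bar>h\<bar>"
    and der: "AE y in lborel. ((\<lambda>t. k (y + t *\<^sub>R b)) has_real_derivative k' y) (at 0)"
    and k': "k' \<in> borel_measurable borel"
    and w: "integrable lborel w"
  shows "((\<lambda>h. \<integral>y. k (y - h *\<^sub>R b) * w y \<partial>lborel) has_real_derivative
          - (\<integral>y. k' y * w y \<partial>lborel)) (at 0)"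
proof -
  have [measurable]: "k \<in> borel_measurable borel" "k' \<in> borel_measurable borel" "w \<in> borel_measurable borel"
    using k k' borel_measurable_integrable[OF w] by auto
  have "((\<lambda>h. \<integral>y. k (y - h *\<^sub>R b) * w y \<partial>lborel) has_real_derivative
          (\<integral>y. - k' y * w y \<partial>lborel)) (at 0)"
  proof (rule has_real_derivative_integral_dominated[where d = 1 and L = "\<lambda>y. L * \<bar>w y\<bar>"])
    show "integrable lborel (\<lambda>y. k (y - t *\<^sub>R b) * w y)" for t
      by (rule integrable_bounded_mult) (use k w in auto)
    show "AE y in lborel. ((\<lambda>t. k (y - t *\<^sub>R b) * w y) has_real_derivative - k' y * w y) (at 0)"
      using der
    proof eventually_elim
      case (elim y)
      have "((\<lambda>t. k (y + t *\<^sub>R b)) \<circ> uminus has_real_derivative k' y * -1) (at 0)"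
        by (rule DERIV_chain) (use elim in \<open>auto intro!: derivative_eq_intros\<close>)
      then have "((\<lambda>t. k (y - t *\<^sub>R b)) has_real_derivative - k' y) (at 0)"
        by (simp add: comp_def)
      then show ?case by (rule DERIV_cmult_right)
    qed
    show "AE y in lborel. \<bar>k (y - t *\<^sub>R b) * w y - k (y - 0 *\<^sub>R b) * w y\<bar> \<le> L * \<bar>w y\<bar> * \<bar>t - 0\<bar>" for t
    proof (rule AE_I2)
      fix y
      have "\<bar>k (y - t *\<^sub>R b) - k y\<bar> * \<bar>w y\<bar> \<le> L * \<bar>t\<bar> * \<bar>w y\<bar>"
        using lip[of y "-t"] by (intro mult_right_mono) auto
      then show "\<bar>k (y - t *\<^sub>R b) * w y - k (y - 0 *\<^sub>R b) * w y\<bar> \<le> L * \<bar>w y\<bar> * \<bar>t - 0\<bar>"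
        by (simp flip: left_diff_distrib) (simp add: abs_mult mult_ac)
    qed
  qed (use w in auto)
  then show ?thesis by simp
qed

lemma lborel_integral_translation:
  fixes f :: "'a::euclidean_space \<Rightarrow> real"
  assumes "f \<in> borel_measurable borel"
  shows "(\<integral>y. f (c + y) \<partial>lborel) = (\<integral>y. f y \<partial>lborel)"
proof -
  have "(\<integral>y. f y \<partial>lborel) = (\<integral>y. f y \<partial>distr lborel borel ((+) c))"
    by (simp add: lborel_distr_plus)
  also have "\<dots> = (\<integral>y. f (c + y) \<partial>lborel)"
    using assms by (subst integral_distr) auto
  finally show ?thesis by simp
qed

text \<open>Both sides are derivatives at \<open>h = 0\<close> of
  \<open>\<integral> k (y - h b) v y dy = \<integral> k y v (y + h b) dy\<close>.\<close>

lemma integral_by_parts_direction: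
  fixes k v :: "'a::euclidean_space \<Rightarrow> real"
  assumes k: "k \<in> borel_measurable borel" "\<And>y. \<bar>k y\<bar> \<le> B"
    and lip: "\<And>y h. \<bar>k (y + h *\<^sub>R b) - k y\<bar> \<le> L * \<bar>h\<bar>"
    and der: "AE y in lborel. ((\<lambda>t. k (y + t *\<^sub>R b)) has_real_derivative k' y) (at 0)"
    and k': "k' \<in> borel_measurable borel"
    and supp: "\<And>y. norm y \<ge> \<rho> \<Longrightarrow> k y = 0" and \<rho>: "\<rho> < \<rho>'"
    and b: "norm b = 1"
    and v: "integrable lborel v" and v': "v' \<in> borel_measurable borel"
    and vder: "\<And>y. norm y < \<rho>' \<Longrightarrow> ((\<lambda>t. v (y + t *\<^sub>R b)) has_real_derivative v' y) (at 0)"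
    and vbd: "\<And>y. norm y < \<rho>' \<Longrightarrow> \<bar>v' y\<bar> \<le> L'"
  shows "(\<integral>y. k' y * v y \<partial>lborel) = - (\<integral>y. k y * v' y \<partial>lborel)"
proof -
  have [measurable]: "k \<in> borel_measurable borel" "v' \<in> borel_measurable borel" "v \<in> borel_measurable borel"
    using k v' borel_measurable_integrable[OF v] by auto
  have "((\<lambda>h. \<integral>y. k (y - h *\<^sub>R b) * v y \<partial>lborel) has_real_derivative
          - (\<integral>y. k' y * v y \<partial>lborel)) (at 0)"
    using k lip der k' v by (rule has_real_derivative_integral_shifted_kernel)
  moreover have "(\<integral>y. k (y - h *\<^sub>R b) * v y \<partial>lborel) = (\<integral>y. k y * v (y + h *\<^sub>R b) \<partial>lborel)" for h
    using lborel_integral_translation[of "\<lambda>y. k (y - h *\<^sub>R b) * v y" "h *\<^sub>R b"]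
    by (simp add: add.commute)
  moreover have "((\<lambda>h. \<integral>y. k y * v (y + h *\<^sub>R b) \<partial>lborel) has_real_derivative
          (\<integral>y. k y * v' y \<partial>lborel)) (at 0)"
  \<comment> \<open>A shift by less than \<open>\<rho>' - \<rho>\<close> keeps the support of k
    inside the ball where v is differentiable with derivative bounded by \<open>L'\<close>. Outside
    \<open>cball 0 \<rho>\<close> the factor k is zero, so a constant on this ball
    dominates.\<close>
  proof (rule has_real_derivative_integral_dominated[where d = "\<rho>' - \<rho>" and L = "\<lambda>y. indicator (cball 0 \<rho>) y * (B * L')"])
    show "0 < \<rho>' - \<rho>" using \<rho> by simp
    show "integrable lborel (\<lambda>y. k y * v (y + t *\<^sub>R b))" for t
    proof (rule integrable_bounded_mult)
      have "integrable (distr lborel borel ((+) (t *\<^sub>R b))) v" using v by (simp add: lborel_distr_plus)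
      then show "integrable lborel (\<lambda>y. v (y + t *\<^sub>R b))"
        by (subst (asm) integrable_distr_eq) (auto simp: add.commute)
    qed (use k in auto)
    show "AE y in lborel. ((\<lambda>t. k y * v (y + t *\<^sub>R b)) has_real_derivative k y * v' y) (at 0)"
    proof (rule AE_I2)
      fix y
      show "((\<lambda>t. k y * v (y + t *\<^sub>R b)) has_real_derivative k y * v' y) (at 0)"
      proof (cases "norm y < \<rho>'")
        case True
        then show ?thesis by (intro DERIV_cmult vder)
      next
        case False
        then show ?thesis using supp[of y] \<rho> by simp
      qed
    qed
    show "AE y in lborel. \<bar>k y * v (y + t *\<^sub>R b) - k y * v (y + 0 *\<^sub>R b)\<bar>
            \<le> indicator (cball 0 \<rho>) y * (B * L') * \<bar>t - 0\<bar>" if t: "\<bar>t - 0\<bar> < \<rho>' - \<rho>" for t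
    proof (rule AE_I2)
      fix y
      show "\<bar>k y * v (y + t *\<^sub>R b) - k y * v (y + 0 *\<^sub>R b)\<bar>
            \<le> indicator (cball 0 \<rho>) y * (B * L') * \<bar>t - 0\<bar>"
      proof (cases "norm y < \<rho>")
        case True
        have n: "norm (y + s *\<^sub>R b) < \<rho>'" if "\<bar>s\<bar> \<le> \<bar>t\<bar>" for s
          using norm_triangle_ineq[of y "s *\<^sub>R b"] that t True b by simp
        have "\<bar>v (y + t *\<^sub>R b) - v y\<bar> \<le> L' * \<bar>t\<bar>"
          by (rule line_lipschitz[where v' = v']) (use n vder vbd in auto)
        then have "\<bar>k y\<bar> * \<bar>v (y + t *\<^sub>R b) - v y\<bar> \<le> B * (L' * \<bar>t\<bar>)"
          by (intro mult_mono) (use k(2)[of y] in auto)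
        then show ?thesis using True
          by (simp add: right_diff_distrib[symmetric] abs_mult mult_ac)
      next
        case False
        then have "k y = 0" using supp by simp
        moreover have "0 \<le> B" using k(2)[of 0] by linarith
        moreover have "0 \<le> L'" if "y \<in> cball 0 \<rho>" using vbd[of y] that \<rho> by simp
        ultimately show ?thesis by (auto simp: indicator_def)
      qed
    qed
    show "integrable lborel (\<lambda>y::'a. indicator (cball 0 \<rho>) y * (B * L'))"
      by (intro integrable_mult_left integrable_real_indicator)
        (auto simp: emeasure_lborel_cball_finite[unfolded infinity_ennreal_def])
  qed auto
  ultimately have "- (\<integral>y. k' y * v y \<partial>lborel) = (\<integral>y. k y * v' y \<partial>lborel)"
    using DERIV_unique by simp
  then show ?thesis by simp
qed

section \<open>Radial kernels\<close>

text \<open>Unlike \<open>(max x 0) ^ p\<close>, this is the indicator of the positive half-line for \<open>p = 0\<close>.\<close>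

definition pos_power :: "nat \<Rightarrow> real \<Rightarrow> real" where
  "pos_power p x = (if 0 < x then x ^ p else 0)"

lemma pos_power_measurable [measurable]: "pos_power p \<in> borel_measurable borel"
  unfolding pos_power_def by measurable

lemma pos_power_nonneg: "0 \<le> pos_power p x"
  by (simp add: pos_power_def)

lemma pos_power_Suc: "pos_power (Suc p) x = x * pos_power p x"
  by (simp add: pos_power_def)

lemma pos_power_Suc_eq_max: "pos_power (Suc p) x = max x 0 ^ Suc p"
  by (auto simp: pos_power_def max_def)

lemma continuous_on_pos_power [continuous_intros]:
  assumes "continuous_on S f"
  shows "continuous_on S (\<lambda>x. pos_power (Suc p) (f x))"
  unfolding pos_power_Suc_eq_max by (intro continuous_intros assms)

lemma pos_power_le:
  assumes "x \<le> M" "0 \<le> M"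
  shows "pos_power p x \<le> M ^ p"
  using assms by (auto simp: pos_power_def intro: power_mono)

text \<open>Negative arguments are cut to 0, so an upper bound on s and t controls the slope. This
  matters because \<open>c - |z|^2\<close> is unbounded below.\<close>

lemma pos_power_lipschitz:
  fixes s t M :: real
  assumes "s \<le> M" "t \<le> M" "0 \<le> M"
  shows "\<bar>pos_power (Suc p) s - pos_power (Suc p) t\<bar> \<le> Suc p * M ^ p * \<bar>s - t\<bar>"
proof (induction p)
  case 0
  then show ?case by (simp add: pos_power_def)
next
  case (Suc p)
  define S T where "S = max s 0" and "T = max t 0"
  have ST: "0 \<le> S" "S \<le> M" "0 \<le> T" "T \<le> M" "\<bar>S - T\<bar> \<le> \<bar>s - t\<bar>"
    using assms by (auto simp: S_def T_def)
  have "S ^ Suc (Suc p) - T ^ Suc (Suc p) = S * (S ^ Suc p - T ^ Suc p) + (S - T) * T ^ Suc p"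
    by (simp add: algebra_simps)
  also have "\<bar>\<dots>\<bar> \<le> \<bar>S\<bar> * \<bar>S ^ Suc p - T ^ Suc p\<bar> + \<bar>S - T\<bar> * \<bar>T ^ Suc p\<bar>"
    unfolding abs_mult[symmetric] by (rule abs_triangle_ineq)
  also have "\<dots> \<le> M * (Suc p * M ^ p * \<bar>s - t\<bar>) + \<bar>s - t\<bar> * M ^ Suc p"
  proof (intro add_mono mult_mono)
    show "\<bar>S ^ Suc p - T ^ Suc p\<bar> \<le> Suc p * M ^ p * \<bar>s - t\<bar>"
      using Suc by (simp add: pos_power_Suc_eq_max S_def T_def)
    have "T ^ Suc p \<le> M ^ Suc p" using ST by (intro power_mono)
    then show "\<bar>T ^ Suc p\<bar> \<le> M ^ Suc p" using ST by simp
  qed (use ST assms in auto)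
  also have "\<dots> = Suc (Suc p) * M ^ Suc p * \<bar>s - t\<bar>" by (simp add: algebra_simps)
  finally show ?case unfolding pos_power_Suc_eq_max S_def T_def .
qed

lemma has_real_derivative_pos_power:
  assumes "x \<noteq> 0 \<or> 0 < p"
  shows "(pos_power (Suc p) has_real_derivative Suc p * pos_power p x) (at x)"
proof -
  consider "x < 0" | "x > 0" | "x = 0" "0 < p" using assms by linarith
  then show ?thesis
  proof cases
    case 1
    have "((\<lambda>_. 0) has_real_derivative 0) (at x)" by simp
    then have "(pos_power (Suc p) has_real_derivative 0) (at x)"
      by (rule has_field_derivative_transform_within_open[where S = "{..<0}"])
        (use 1 in \<open>auto simp: pos_power_def\<close>)
    then show ?thesis using 1 by (simp add: pos_power_def)
  next
    case 2
    have "((\<lambda>x. x ^ Suc p) has_real_derivative Suc p * x ^ p) (at x)"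
      using DERIV_pow[of "Suc p" x] by simp
    then have "(pos_power (Suc p) has_real_derivative Suc p * x ^ p) (at x)"
      by (rule has_field_derivative_transform_within_open[where S = "{0<..}"])
        (use 2 in \<open>auto simp: pos_power_def\<close>)
    then show ?thesis using 2 by (simp add: pos_power_def)
  next
    \<comment> \<open>At the corner the difference quotient is \<open>pos_power p y\<close>, which
      tends to 0 because p is positive.\<close>
    case 3
    then obtain q where q: "p = Suc q" by (cases p) auto
    have "((\<lambda>y. pos_power p y) \<longlongrightarrow> pos_power p 0) (at 0)"
      using continuous_on_pos_power[of UNIV "\<lambda>y. y" q] unfolding q
      by (simp add: continuous_on_def)
    then have "((\<lambda>y. pos_power (Suc p) y / y) \<longlongrightarrow> pos_power p 0) (at 0)"
      by (rule Lim_transform_eventually) (auto simp: eventually_at_filter pos_power_Suc)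
    then show ?thesis
      using 3 by (simp add: has_field_derivative_iff pos_power_def)
  qed
qed

text \<open>The parameter c is the squared radius. It enters linearly, so differentiating in c
  amounts to differentiating \<open>pos_power\<close>, and no norm, singular at the centre, appears
  when differentiating in z.\<close>

definition bump :: "real \<Rightarrow> nat \<Rightarrow> 'a::euclidean_space \<Rightarrow> real" where
  "bump c p z = pos_power p (c - z \<bullet> z)"

lemma bump_measurable [measurable]: "bump c p \<in> borel_measurable borel"
  unfolding bump_def by measurable

lemma continuous_on_bump: "continuous_on S (bump c (Suc p))"
  unfolding bump_def by (intro continuous_intros)

lemma bump_nonneg: "0 \<le> bump c p z"
  by (simp add: bump_def pos_power_nonneg)

lemma bump_Suc: "bump c (Suc p) z = (c - z \<bullet> z) * bump c p z"
  by (simp add: bump_def pos_power_Suc)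

lemma bump_bounded: "0 \<le> c \<Longrightarrow> \<bar>bump c p z\<bar> \<le> c ^ p"
  using pos_power_le[of "c - z \<bullet> z" c p] bump_nonneg[of c p z] by (simp add: bump_def)

lemma bump_eq_0:
  assumes "R \<le> norm z" "0 \<le> R"
  shows "bump (R\<^sup>2) p z = 0"
proof -
  have "R\<^sup>2 \<le> z \<bullet> z" unfolding dot_square_norm using assms by (simp add: power_mono)
  then show ?thesis by (simp add: bump_def pos_power_def)
qed

lemma bump_0_eq_indicator:
  assumes "0 \<le> R"
  shows "bump (R\<^sup>2) 0 z = indicator (ball 0 R) z"
proof -
  have "z \<bullet> z < R\<^sup>2 \<longleftrightarrow> norm z < R"
    unfolding dot_square_norm using assms
    by (meson norm_ge_zero pos2 power_mono_iff power_strict_mono not_less)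
  then show ?thesis by (simp add: bump_def pos_power_def indicator_def)
qed

lemma has_real_derivative_bump:
  assumes "c \<noteq> z \<bullet> z \<or> 0 < p"
  shows "((\<lambda>t. bump c (Suc p) (z + t *\<^sub>R b)) has_real_derivative
            - 2 * Suc p * (z \<bullet> b) * bump c p z) (at 0)"
proof -
  have "((\<lambda>t. c - (z + t *\<^sub>R b) \<bullet> (z + t *\<^sub>R b)) has_real_derivative - 2 * (z \<bullet> b)) (at 0)"
    unfolding inner_add_left inner_add_right inner_scaleR_left inner_scaleR_right
    by (auto intro!: derivative_eq_intros simp: inner_commute)
  moreover have "(pos_power (Suc p) has_real_derivative Suc p * bump c p z)
      (at (c - (z + 0 *\<^sub>R b) \<bullet> (z + 0 *\<^sub>R b)))"
    using has_real_derivative_pos_power[of "c - z \<bullet> z" p] assms by (simp add: bump_def)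
  ultimately have "(pos_power (Suc p) \<circ> (\<lambda>t. c - (z + t *\<^sub>R b) \<bullet> (z + t *\<^sub>R b)) has_real_derivative
      Suc p * bump c p z * (- 2 * (z \<bullet> b))) (at 0)"
    by (intro DERIV_chain)
  then have "((\<lambda>t. bump c (Suc p) (z + t *\<^sub>R b)) has_real_derivative
      Suc p * bump c p z * (- 2 * (z \<bullet> b))) (at 0)"
    by (simp only: comp_def bump_def)
  then show ?thesis by (rule DERIV_cong) (simp add: algebra_simps)
qed

section \<open>From ball averages to averages against the kernels\<close>

text \<open>The points where exponent 1 fails to be differentiable form a sphere, hence a null
  set.\<close>

lemma AE_lborel_sphere: "AE y in lborel. c \<noteq> (y - x) \<bullet> (y - (x::'a::euclidean_space))"
proof (rule AE_I')
  show "sphere x (sqrt c) \<in> null_sets (lborel :: 'a measure)"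
    using negligible_sphere[of x "sqrt c"]
    by (simp add: negligible_iff_null_sets null_sets_completion_iff)
  show "{y \<in> space lborel. \<not> c \<noteq> (y - x) \<bullet> (y - x)} \<subseteq> sphere x (sqrt c)"
  proof -
    have "dist x y = sqrt ((y - x) \<bullet> (y - x))" for y
      by (metis dist_commute dist_norm norm_eq_sqrt_inner)
    then show ?thesis by auto
  qed
qed

text \<open>Differentiating in \<open>a\<close> lowers the exponent by one, so the vanishing of the ball integrals
  (the case \<open>p = 0\<close>) propagates to all \<open>p\<close>.\<close>

lemma integral_bump_eq_0:
  fixes w :: "'a::euclidean_space \<Rightarrow> real"
  assumes w: "integrable lborel w"
    and ball: "\<And>r. 0 < r \<Longrightarrow> r \<le> R \<Longrightarrow> (\<integral>y. indicator (ball x r) y * w y \<partial>lborel) = 0"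
    and a: "a \<le> R\<^sup>2" and R: "0 < R"
  shows "(\<integral>y. bump a p (y - x) * w y \<partial>lborel) = 0"
  using a
proof (induction p arbitrary: a)
  case 0
  show ?case
  proof (cases "0 < a")
    case True
    have "bump a 0 (y - x) = indicator (ball x (sqrt a)) y" for y
      using bump_0_eq_indicator[of "sqrt a" "y - x"] True
      by (simp add: indicator_def dist_norm norm_minus_commute)
    moreover have "sqrt a \<le> R" using 0 R by (simp add: real_le_lsqrt)
    ultimately show ?thesis using ball[of "sqrt a"] True by simp
  next
    case False
    have "bump a 0 (y - x) = 0" for y
    proof -
      have "\<not> (y - x) \<bullet> (y - x) < a" using False inner_ge_zero[of "y - x"] by linarith
      then show ?thesis by (simp add: bump_def pos_power_def)
    qed
    then show ?thesis by simp
  qed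
next
  case (Suc p)
  define \<Phi> where "\<Phi> p a = (\<integral>y. bump a p (y - x) * w y \<partial>lborel)" for p a
  have [measurable]: "w \<in> borel_measurable borel" using borel_measurable_integrable[OF w] by simp
  have der: "(\<Phi> (Suc p) has_real_derivative Suc p * \<Phi> p a) (at a)" for a
  proof -
    have "(\<Phi> (Suc p) has_real_derivative (\<integral>y. Suc p * bump a p (y - x) * w y \<partial>lborel)) (at a)"
      unfolding \<Phi>_def[abs_def]
    proof (rule has_real_derivative_integral_dominated[where d = 1
            and L = "\<lambda>y. (Suc p * (\<bar>a\<bar> + 1) ^ p) * \<bar>w y\<bar>"])
      show "integrable lborel (\<lambda>y. bump t (Suc p) (y - x) * w y)" for t
      proof (rule integrable_bounded_mult)
        show "\<bar>bump t (Suc p) (y - x)\<bar> \<le> \<bar>t\<bar> ^ Suc p" for y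
          using pos_power_le[of "t - (y - x) \<bullet> (y - x)" "\<bar>t\<bar>" "Suc p"]
            inner_ge_zero[of "y - x"] bump_nonneg[of t "Suc p" "y - x"]
          unfolding bump_def by (smt (verit))
      qed (use w in auto)
      show "AE y in lborel. ((\<lambda>t. bump t (Suc p) (y - x) * w y) has_real_derivative
              Suc p * bump a p (y - x) * w y) (at a)"
        using AE_lborel_sphere[of a x]
      proof eventually_elim
        case (elim y)
        have "(pos_power (Suc p) \<circ> (\<lambda>t. t - (y - x) \<bullet> (y - x)) has_real_derivative
            Suc p * pos_power p (a - (y - x) \<bullet> (y - x)) * 1) (at a)"
          by (rule DERIV_chain[OF has_real_derivative_pos_power])
            (use elim in \<open>auto intro!: derivative_eq_intros\<close>)
        then show ?case
          by (intro DERIV_cmult_right) (simp add: bump_def comp_def)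
      qed
      show "AE y in lborel. \<bar>bump t (Suc p) (y - x) * w y - bump a (Suc p) (y - x) * w y\<bar>
          \<le> (Suc p * (\<bar>a\<bar> + 1) ^ p) * \<bar>w y\<bar> * \<bar>t - a\<bar>" if "\<bar>t - a\<bar> < 1" for t
      proof (rule AE_I2)
        fix y
        have "\<bar>bump t (Suc p) (y - x) - bump a (Suc p) (y - x)\<bar>
            \<le> Suc p * (\<bar>a\<bar> + 1) ^ p * \<bar>(t - (y - x) \<bullet> (y - x)) - (a - (y - x) \<bullet> (y - x))\<bar>"
          unfolding bump_def
          by (rule pos_power_lipschitz) (use that inner_ge_zero[of "y - x"] in linarith)+
        then have "\<bar>bump t (Suc p) (y - x) - bump a (Suc p) (y - x)\<bar> * \<bar>w y\<bar>
            \<le> Suc p * (\<bar>a\<bar> + 1) ^ p * \<bar>t - a\<bar> * \<bar>w y\<bar>"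
          by (intro mult_right_mono) auto
        then show "\<bar>bump t (Suc p) (y - x) * w y - bump a (Suc p) (y - x) * w y\<bar>
          \<le> (Suc p * (\<bar>a\<bar> + 1) ^ p) * \<bar>w y\<bar> * \<bar>t - a\<bar>"
          by (simp flip: left_diff_distrib) (simp add: abs_mult mult_ac)
      qed
    qed (use w in auto)
    then show ?thesis by (simp add: \<Phi>_def mult.assoc)
  qed
  have der0: "(\<Phi> (Suc p) has_real_derivative 0) (at t within {..R\<^sup>2})" if "t \<in> {..R\<^sup>2}" for t
  proof -
    have "\<Phi> p t = 0" unfolding \<Phi>_def using Suc.IH[of t] that by simp
    then show ?thesis using der[of t] has_field_derivative_at_within by fastforce
  qed
  \<comment> \<open>The half-line is convex and contains 0, where \<open>bump 0 (Suc p)\<close>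
    vanishes identically; this value fixes the constant.\<close>
  have "\<exists>c. \<forall>t\<in>{..R\<^sup>2}. \<Phi> (Suc p) t = c"
    by (rule has_field_derivative_zero_constant) (use der0 in auto)
  then have "\<Phi> (Suc p) a = \<Phi> (Suc p) 0" using Suc.prems by auto
  also have "\<dots> = 0"
  proof -
    have "bump 0 (Suc p) (y - x) = 0" for y
    proof -
      have "\<not> (y - x) \<bullet> (y - x) < 0" using inner_ge_zero[of "y - x"] by linarith
      then show ?thesis by (simp add: bump_def pos_power_def)
    qed
    then show ?thesis by (simp add: \<Phi>_def)
  qed
  finally show ?case by (simp add: \<Phi>_def)
qed

lemma integrable_bump:
  assumes "0 \<le> R"
  shows "integrable lborel (bump (R\<^sup>2) p :: 'a::euclidean_space \<Rightarrow> real)"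
proof -
  have "integrable lborel (\<lambda>y::'a. bump (R\<^sup>2) p y * indicator (ball 0 R) y)"
    by (rule integrable_bounded_mult[OF _ bump_bounded])
      (auto intro!: integrable_real_indicator simp: emeasure_lborel_ball_finite[unfolded infinity_ennreal_def])
  moreover have "bump (R\<^sup>2) p y * indicator (ball 0 R) y = bump (R\<^sup>2) p y" for y :: 'a
    using bump_eq_0[of R y p] assms by (auto simp: indicator_def)
  ultimately show ?thesis by simp
qed

text \<open>Subtracting the constant m from w makes all the ball integrals vanish, which reduces the
  claim to the preceding lemma. The constant is cut off to \<open>ball x R\<close> to remain
  integrable.\<close>

lemma integral_bump_eq_mean:
  fixes w :: "'a::euclidean_space \<Rightarrow> real"
  assumes w: "integrable lborel w" and R: "0 < R"
    and ball: "\<And>r. 0 < r \<Longrightarrow> r \<le> R \<Longrightarrow>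
      (\<integral>y. indicator (ball x r) y * w y \<partial>lborel) = m * measure lborel (ball x r)"
  shows "(\<integral>y. bump (R\<^sup>2) p (y - x) * w y \<partial>lborel) = m * (\<integral>z. bump (R\<^sup>2) p (z::'a) \<partial>lborel)"
proof -
  have [measurable]: "w \<in> borel_measurable borel" using borel_measurable_integrable[OF w] by simp
  have ind: "integrable lborel (indicator (ball x r) :: 'a \<Rightarrow> real)" for r
    by (intro integrable_real_indicator) (auto simp: emeasure_lborel_ball_finite[unfolded infinity_ennreal_def])
  have iw: "integrable lborel (\<lambda>y. k y * w y)"
    if "k \<in> borel_measurable borel" "\<And>y. \<bar>k y\<bar> \<le> B" for k B
    by (rule integrable_bounded_mult) (use that w in auto)
  have ii: "integrable lborel (\<lambda>y. k y * (m * indicator (ball x R) y))"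
    if "k \<in> borel_measurable borel" "\<And>y. \<bar>k y\<bar> \<le> B" for k B
    by (rule integrable_bounded_mult) (use that ind in auto)
  have "(\<integral>y. bump (R\<^sup>2) p (y - x) * (w y - m * indicator (ball x R) y) \<partial>lborel) = 0"
  proof (rule integral_bump_eq_0[OF _ _ order_refl R])
    show "integrable lborel (\<lambda>y. w y - m * indicator (ball x R) y)" using w ind by auto
    fix r :: real assume r: "0 < r" "r \<le> R"
    have ind_meas: "(indicator (ball x r) :: 'a \<Rightarrow> real) \<in> borel_measurable borel"
      by (rule borel_measurable_indicator) simp
    have bd: "\<bar>indicator (ball x r) y :: real\<bar> \<le> 1" for y by (simp add: indicator_def)
    have "(\<integral>y. indicator (ball x r) y * (w y - m * indicator (ball x R) y) \<partial>lborel)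
      = (\<integral>y. indicator (ball x r) y * w y \<partial>lborel)
        - (\<integral>y. indicator (ball x r) y * (m * indicator (ball x R) y) \<partial>lborel)"
      unfolding right_diff_distrib
      by (rule Bochner_Integration.integral_diff)
        (use iw[OF ind_meas bd] ii[OF ind_meas bd] in simp_all)
    also have "(\<lambda>y. indicator (ball x r) y * (m * indicator (ball x R) y)) = (\<lambda>y. m * indicator (ball x r) y)"
      using r by (auto simp: indicator_def)
    finally show "(\<integral>y. indicator (ball x r) y * (w y - m * indicator (ball x R) y) \<partial>lborel) = 0"
      using ball[OF r] by simp
  qed
  moreover have "(\<integral>y. bump (R\<^sup>2) p (y - x) * (w y - m * indicator (ball x R) y) \<partial>lborel)
      = (\<integral>y. bump (R\<^sup>2) p (y - x) * w y \<partial>lborel)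
        - (\<integral>y. bump (R\<^sup>2) p (y - x) * (m * indicator (ball x R) y) \<partial>lborel)"
    unfolding right_diff_distrib
    by (rule Bochner_Integration.integral_diff; rule iw ii, measurable, rule bump_bounded) simp_all
  \<comment> \<open>The kernel vanishes off \<open>ball x R\<close>, so the cut-off drops out, and a
    translation centres the kernel at the origin.\<close>
  moreover have "bump (R\<^sup>2) p (y - x) * (m * indicator (ball x R) y) = m * bump (R\<^sup>2) p (- x + y)" for y
    using bump_eq_0[of R "y - x" p] R
    by (auto simp: indicator_def dist_norm norm_minus_commute[of x] add.commute)
  ultimately show ?thesis
    using lborel_integral_translation[of "bump (R\<^sup>2) p" "- x"] by simp
qed

lemma integral_bump_pos:
  assumes "0 < R"
  shows "0 < (\<integral>z. bump (R\<^sup>2) p (z::'a::euclidean_space) \<partial>lborel)"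
proof (rule ccontr)
  assume "\<not> ?thesis"
  then have "(\<integral>z. bump (R\<^sup>2) p (z::'a) \<partial>lborel) = 0"
    using Bochner_Integration.integral_nonneg[of lborel "bump (R\<^sup>2) p :: 'a \<Rightarrow> real"] bump_nonneg[of "R\<^sup>2" p]
    by fastforce
  then have "AE z in lborel. bump (R\<^sup>2) p (z::'a) = 0"
    using integral_nonneg_eq_0_iff_AE[of lborel "bump (R\<^sup>2) p :: 'a \<Rightarrow> real"] integrable_bump[of R p] bump_nonneg assms
    by auto
  then have "AE z in lborel. (z::'a) \<notin> ball 0 R"
  proof eventually_elim
    case (elim z)
    have "z \<bullet> z < R\<^sup>2" if "norm z < R"
      unfolding dot_square_norm using that by (intro power_strict_mono) auto
    then show ?case using elim by (auto simp: bump_def pos_power_def split: if_splits)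
  qed
  then have "emeasure lborel (ball (0::'a) R) = 0"
    by (subst (asm) AE_iff_measurable[where N = "ball 0 R"]) auto
  then have "measure lborel (ball (0::'a) R) = 0" by (simp add: measure_def)
  then show False using content_ball_pos[OF assms, of "0::'a"] by simp
qed

section \<open>From the mean value property to harmonicity\<close>

lemma partial_derivI:
  assumes "((\<lambda>t. f (x + t *\<^sub>R b)) has_real_derivative D) (at 0)"
  shows "partial_deriv b f x = D" "(\<lambda>t. f (x + t *\<^sub>R b)) differentiable at 0"
  using assms DERIV_imp_deriv real_differentiable_def unfolding partial_deriv_def by blast+

lemma has_real_derivative_partial_deriv:
  assumes "C1_fun_on D f" "x \<in> D" "b \<in> Basis"
  shows "((\<lambda>t. f (x + t *\<^sub>R b)) has_real_derivative partial_deriv b f x) (at 0)"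
  using assms unfolding C1_fun_on_def partial_deriv_def
  by (simp add: DERIV_deriv_iff_real_differentiable)

lemma eventually_line_mem:
  fixes x b :: "'a::real_normed_vector"
  assumes "open D" "x \<in> D"
  shows "eventually (\<lambda>t. x + t *\<^sub>R b \<in> D) (nhds (0::real))"
proof -
  have "((\<lambda>t. x + t *\<^sub>R b) \<longlongrightarrow> x + 0 *\<^sub>R b) (nhds 0)"
    by (intro tendsto_intros filterlim_ident)
  then show ?thesis using assms by (simp add: topological_tendstoD)
qed

text \<open>\<open>partial_deriv\<close> reads a total function, but only its values near x count,
  since a short piece of the line stays in D. This later allows a function to be replaced by a
  convolution or a cut-off that agrees with it on an open set.\<close>

lemma has_real_derivative_line_cong:
  fixes f g :: "'a::real_normed_vector \<Rightarrow> real"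
  assumes "open D" "x \<in> D" "\<And>y. y \<in> D \<Longrightarrow> f y = g y"
  shows "((\<lambda>t. f (x + t *\<^sub>R b)) has_real_derivative D') (at 0) \<longleftrightarrow>
         ((\<lambda>t. g (x + t *\<^sub>R b)) has_real_derivative D') (at 0)"
  by (rule DERIV_cong_ev[OF refl _ refl])
    (use eventually_line_mem[OF assms(1,2), of b] assms(3) in \<open>auto elim: eventually_mono\<close>)

lemma partial_deriv_cong:
  assumes "open D" "x \<in> D" "\<And>y. y \<in> D \<Longrightarrow> f y = g y"
  shows "partial_deriv b f x = partial_deriv b g x"
  using has_real_derivative_line_cong[of D x f g b] assms
  by (simp add: partial_deriv_def deriv_def)

lemma C1_fun_on_cong:
  assumes "open D" "\<And>y. y \<in> D \<Longrightarrow> f y = g y"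
  shows "C1_fun_on D f \<longleftrightarrow> C1_fun_on D g"
proof -
  have "continuous_on D (partial_deriv b f) \<longleftrightarrow> continuous_on D (partial_deriv b g)" for b
    by (rule continuous_on_cong) (use partial_deriv_cong[of D _ f g] assms in auto)
  then show ?thesis
    unfolding C1_fun_on_def real_differentiable_def
    using has_real_derivative_line_cong[of D _ f g] assms by simp
qed

lemma harmonic_fun_on_cong:
  assumes "open D" "\<And>y. y \<in> D \<Longrightarrow> f y = g y"
  shows "harmonic_fun_on D f \<longleftrightarrow> harmonic_fun_on D g"
proof -
  have pd: "partial_deriv b f y = partial_deriv b g y" if "y \<in> D" for b y
    using partial_deriv_cong[of D y f g] assms that by blast
  have "laplacian f y = laplacian g y" if "y \<in> D" for y
    unfolding laplacian_def
    using partial_deriv_cong[of D y "partial_deriv _ f" "partial_deriv _ g"] assms(1) pd that by (intro sum.cong) auto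
  then show ?thesis
    unfolding harmonic_fun_on_def C2_fun_on_def
    using C1_fun_on_cong[of D f g] C1_fun_on_cong[of D "partial_deriv _ f" "partial_deriv _ g"] assms pd
    by simp
qed

lemma C1_fun_on_local:
  assumes "\<And>x. x \<in> D \<Longrightarrow> \<exists>S. open S \<and> x \<in> S \<and> C1_fun_on S f"
  shows "C1_fun_on D f"
  unfolding C1_fun_on_def
proof (intro ballI conjI)
  fix b :: 'a assume b: "b \<in> Basis"
  show "(\<lambda>t. f (x + t *\<^sub>R b)) differentiable at 0" if "x \<in> D" for x
    using assms[OF that] b unfolding C1_fun_on_def by blast
  show "continuous_on D (partial_deriv b f)"
  proof (rule continuous_at_imp_continuous_on, rule ballI)
    fix x assume "x \<in> D"
    then obtain S where "open S" "x \<in> S" "C1_fun_on S f" using assms by blast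
    then show "isCont (partial_deriv b f) x"
      using b continuous_on_eq_continuous_at unfolding C1_fun_on_def by blast
  qed
qed

text \<open>The admissible radii depend on the distance to the boundary, so the representation by a
  convolution is available only near one point at a time.\<close>

lemma harmonic_fun_on_local:
  assumes "\<And>x. x \<in> D \<Longrightarrow> \<exists>S. open S \<and> x \<in> S \<and> harmonic_fun_on S f"
  shows "harmonic_fun_on D f"
  unfolding harmonic_fun_on_def C2_fun_on_def
proof (intro conjI ballI)
  show "C1_fun_on D f"
    using assms unfolding harmonic_fun_on_def C2_fun_on_def by (intro C1_fun_on_local) metis
  show "C1_fun_on D (partial_deriv b f)" if "b \<in> Basis" for b
    using assms that unfolding harmonic_fun_on_def C2_fun_on_def by (intro C1_fun_on_local) metis
  show "laplacian f x = 0" if "x \<in> D" for x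
    using assms[OF that] by (auto simp: harmonic_fun_on_def)
qed

lemma C1_fun_on_subset: "C1_fun_on D f \<Longrightarrow> S \<subseteq> D \<Longrightarrow> C1_fun_on S f"
  unfolding C1_fun_on_def by (meson continuous_on_subset subsetD)

section \<open>Convolutions with a smooth kernel\<close>

text \<open>Moving x by \<open>t b\<close> moves the argument of the kernel by \<open>- t b\<close>,
  hence the minus sign. The bound on \<open>k'\<close> supplies the Lipschitz constant.\<close>

lemma has_real_derivative_convolution:
  fixes k w :: "'a::euclidean_space \<Rightarrow> real"
  assumes k: "continuous_on UNIV k" "\<And>y. \<bar>k y\<bar> \<le> B"
    and der: "\<And>y. ((\<lambda>t. k (y + t *\<^sub>R b)) has_real_derivative k' y) (at 0)"
    and k': "continuous_on UNIV k'" "\<And>y. \<bar>k' y\<bar> \<le> B'"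
    and w: "integrable lborel w"
  shows "((\<lambda>t. (\<lambda>x. \<integral>y. k (y - x) * w y \<partial>lborel) (x + t *\<^sub>R b)) has_real_derivative
            - (\<integral>y. k' (y - x) * w y \<partial>lborel)) (at 0)"
proof -
  have [measurable]: "k \<in> borel_measurable borel" "k' \<in> borel_measurable borel"
    using k(1) k'(1) by (auto intro: borel_measurable_continuous_onI)
  have "((\<lambda>t. \<integral>y. k (y - t *\<^sub>R b - x) * w y \<partial>lborel) has_real_derivative
            - (\<integral>y. k' (y - x) * w y \<partial>lborel)) (at 0)"
  proof (rule has_real_derivative_integral_shifted_kernel[where k = "\<lambda>y. k (y - x)" and k' = "\<lambda>y. k' (y - x)"])
    show "\<bar>k (y + h *\<^sub>R b - x) - k (y - x)\<bar> \<le> B' * \<bar>h\<bar>" for y h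
    proof -
      have "\<bar>k (y - x + h *\<^sub>R b) - k (y - x)\<bar> \<le> B' * \<bar>h\<bar>"
        by (rule line_lipschitz[where v' = k']) (use der k' in auto)
      then show ?thesis by (simp add: diff_add_eq)
    qed
    show "AE y in lborel. ((\<lambda>t. k (y + t *\<^sub>R b - x)) has_real_derivative k' (y - x)) (at 0)"
      using der[of "_ - x"] by (simp add: diff_add_eq)
  qed (use k w in auto)
  then show ?thesis by (simp add: algebra_simps)
qed

lemma continuous_on_convolution:
  fixes k w :: "'a::euclidean_space \<Rightarrow> real"
  assumes k: "continuous_on UNIV k" "\<And>y. \<bar>k y\<bar> \<le> B" and w: "integrable lborel w"
  shows "continuous_on S (\<lambda>x. \<integral>y. k (y - x) * w y \<partial>lborel)"
proof (rule continuous_on_integral_bounded_kernel[where w = "\<lambda>y. B * \<bar>w y\<bar>"])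
  have [measurable]: "k \<in> borel_measurable borel"
    using k(1) by (rule borel_measurable_continuous_onI)
  show "(\<lambda>y. k (y - x) * w y) \<in> borel_measurable lborel" for x
    using borel_measurable_integrable[OF w] by measurable
  show "\<bar>k (y - x) * w y\<bar> \<le> B * \<bar>w y\<bar>" for x y
    unfolding abs_mult by (intro mult_right_mono k) simp
  show "continuous_on S (\<lambda>x. k (y - x) * w y)" for y
    by (intro continuous_intros continuous_on_compose2[OF k(1)]) auto
qed (use w in auto)

text \<open>The partial derivatives are exhibited as convolutions again, with kernel
  \<open>- k' b\<close>, so that the lemma can be applied to its own output to reach second
  order.\<close>

lemma C1_fun_on_convolution:
  fixes k w :: "'a::euclidean_space \<Rightarrow> real"
  assumes k: "continuous_on UNIV k" "\<And>y. \<bar>k y\<bar> \<le> B"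
    and der: "\<And>b y. b \<in> Basis \<Longrightarrow> ((\<lambda>t. k (y + t *\<^sub>R b)) has_real_derivative k' b y) (at 0)"
    and k': "\<And>b. b \<in> Basis \<Longrightarrow> continuous_on UNIV (k' b)"
      "\<And>b y. b \<in> Basis \<Longrightarrow> \<bar>k' b y\<bar> \<le> B'"
    and w: "integrable lborel w"
  shows "C1_fun_on UNIV (\<lambda>x. \<integral>y. k (y - x) * w y \<partial>lborel)"
    and "\<And>b. b \<in> Basis \<Longrightarrow> partial_deriv b (\<lambda>x. \<integral>y. k (y - x) * w y \<partial>lborel)
          = (\<lambda>x. \<integral>y. - k' b (y - x) * w y \<partial>lborel)"
proof -
  note d = has_real_derivative_convolution[OF k der k' w]
  show pd: "partial_deriv b (\<lambda>x. \<integral>y. k (y - x) * w y \<partial>lborel)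
          = (\<lambda>x. \<integral>y. - k' b (y - x) * w y \<partial>lborel)" if "b \<in> Basis" for b
    using partial_derivI(1)[OF d] that by (intro ext) simp
  show "C1_fun_on UNIV (\<lambda>x. \<integral>y. k (y - x) * w y \<partial>lborel)"
    unfolding C1_fun_on_def
  proof (intro ballI conjI)
    fix b :: 'a assume b: "b \<in> Basis"
    show "(\<lambda>t. \<integral>y. k (y - (x + t *\<^sub>R b)) * w y \<partial>lborel) differentiable at 0" for x
      using partial_derivI(2)[OF d] b by auto
    show "continuous_on UNIV (partial_deriv b (\<lambda>x. \<integral>y. k (y - x) * w y \<partial>lborel))"
      unfolding pd[OF b]
      by (rule continuous_on_convolution[where B = B']) (use k' w b in \<open>auto intro!: continuous_intros\<close>)
  qed
qed

section \<open>The kernel of exponent 4 and its Laplacian\<close>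

lemma inner_mult_bump_bounded:
  assumes "0 \<le> R" "norm b \<le> 1"
  shows "\<bar>(z \<bullet> b) * bump (R\<^sup>2) p z\<bar> \<le> R * (R\<^sup>2) ^ p"
proof (cases "norm z < R")
  case True
  have "\<bar>z \<bullet> b\<bar> \<le> norm z * norm b" by (rule Cauchy_Schwarz_ineq2)
  also have "\<dots> \<le> R * 1" using assms True by (intro mult_mono) auto
  finally show ?thesis
    unfolding abs_mult using assms by (intro mult_mono bump_bounded) auto
next
  case False
  then show ?thesis using assms by (simp add: bump_eq_0)
qed

text \<open>First and second derivatives of \<open>bump c 4\<close> in the directions \<open>b\<close> and \<open>b, b'\<close>.\<close>

definition bump_D1 :: "real \<Rightarrow> 'a::euclidean_space \<Rightarrow> 'a \<Rightarrow> real" where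
  "bump_D1 c b z = - 8 * (z \<bullet> b) * bump c 3 z"

definition bump_D2 :: "real \<Rightarrow> 'a::euclidean_space \<Rightarrow> 'a \<Rightarrow> 'a \<Rightarrow> real" where
  "bump_D2 c b b' z = - 8 * (b \<bullet> b') * bump c 3 z + 48 * (z \<bullet> b) * (z \<bullet> b') * bump c 2 z"

text \<open>A numeral exponent is positive, which excludes the discontinuous indicator. Two
  derivatives of exponent 4 leave the exponents 3 and 2, so they are continuous even across the
  sphere.\<close>

lemma continuous_on_bump_numeral: "continuous_on S (bump c (numeral n))"
  unfolding numeral_eq_Suc by (rule continuous_on_bump)

lemma continuous_on_bump_D1: "continuous_on S (bump_D1 c b)"
  unfolding bump_D1_def by (intro continuous_intros continuous_on_bump_numeral)

lemma continuous_on_bump_D2: "continuous_on S (bump_D2 c b b')"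
  unfolding bump_D2_def by (intro continuous_intros continuous_on_bump_numeral)

lemma bump_D1_bounded:
  assumes "0 \<le> R" "b \<in> Basis"
  shows "\<bar>bump_D1 (R\<^sup>2) b z\<bar> \<le> 8 * (R * (R\<^sup>2) ^ 3)"
  using inner_mult_bump_bounded[of R b z 3] assms
  by (simp add: bump_D1_def abs_mult mult.assoc)

lemma bump_D2_bounded:
  assumes R: "0 \<le> R" and b: "b \<in> Basis" "b' \<in> Basis"
  shows "\<bar>bump_D2 (R\<^sup>2) b b' z\<bar> \<le> 8 * (R\<^sup>2) ^ 3 + 48 * (R * (R * (R\<^sup>2) ^ 2))"
proof -
  have 1: "\<bar>(b \<bullet> b') * bump (R\<^sup>2) 3 z\<bar> \<le> 1 * (R\<^sup>2) ^ 3"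
    unfolding abs_mult by (intro mult_mono bump_bounded) (use b in \<open>auto simp: inner_Basis\<close>)
  have 2: "\<bar>(z \<bullet> b) * ((z \<bullet> b') * bump (R\<^sup>2) 2 z)\<bar> \<le> R * (R * (R\<^sup>2) ^ 2)"
  proof (cases "norm z < R")
    case True
    have "\<bar>z \<bullet> b\<bar> \<le> R" using Basis_le_norm[OF b(1), of z] True by simp
    then show ?thesis
      unfolding abs_mult[of "z \<bullet> b"] using R b
      by (intro mult_mono inner_mult_bump_bounded) auto
  next
    case False
    then show ?thesis using assms by (simp add: bump_eq_0)
  qed
  have "bump_D2 (R\<^sup>2) b b' z = - 8 * ((b \<bullet> b') * bump (R\<^sup>2) 3 z) + 48 * ((z \<bullet> b) * ((z \<bullet> b') * bump (R\<^sup>2) 2 z))"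
    by (simp add: bump_D2_def mult_ac)
  then show ?thesis using 1 2 by linarith
qed

lemma has_real_derivative_bump_4:
  "((\<lambda>t. bump c 4 (z + t *\<^sub>R b)) has_real_derivative bump_D1 c b z) (at 0)"
  using has_real_derivative_bump[of c z 3 b]
  by (simp add: bump_D1_def numeral_eq_Suc mult_ac)

lemma has_real_derivative_bump_D1:
  "((\<lambda>t. bump_D1 c b (z + t *\<^sub>R b')) has_real_derivative bump_D2 c b b' z) (at 0)"
proof -
  have "((\<lambda>t. bump c 3 (z + t *\<^sub>R b')) has_real_derivative - 6 * (z \<bullet> b') * bump c 2 z) (at 0)"
    using has_real_derivative_bump[of c z 2 b'] by (simp add: numeral_eq_Suc mult_ac)
  then have "((\<lambda>t. - 8 * ((z + t *\<^sub>R b') \<bullet> b) * bump c 3 (z + t *\<^sub>R b')) has_real_derivative bump_D2 c b b' z) (at 0)"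
    unfolding inner_add_left inner_scaleR_left
    by (auto intro!: derivative_eq_intros simp: bump_D2_def inner_commute algebra_simps)
  then show ?thesis by (simp add: bump_D1_def)
qed

text \<open>The derivative of a compactly supported function integrates to zero: integrate by parts
  against the constant 1. To be integrable, the constant is cut off at radius \<open>R + 1\<close>,
  which leaves it locally constant around the support of the kernel.\<close>

lemma integral_bump_D2_eq_0:
  fixes b :: "'a::euclidean_space"
  assumes R: "0 < R" and b: "b \<in> Basis"
  shows "(\<integral>z. bump_D2 (R\<^sup>2) b b z \<partial>lborel) = 0"
proof -
  have "(\<integral>z. bump_D2 (R\<^sup>2) b b z * indicator (ball 0 (R + 1)) z \<partial>lborel)
      = - (\<integral>z. bump_D1 (R\<^sup>2) b z * 0 \<partial>lborel)"
  proof (rule integral_by_parts_direction[where \<rho> = R and \<rho>' = "R + 1" and L' = 0])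
    show "bump_D1 (R\<^sup>2) b \<in> borel_measurable borel" "bump_D2 (R\<^sup>2) b b \<in> borel_measurable borel"
      by (auto intro: borel_measurable_continuous_onI continuous_on_bump_D1 continuous_on_bump_D2)
    show "\<bar>bump_D1 (R\<^sup>2) b y\<bar> \<le> 8 * (R * (R\<^sup>2) ^ 3)" for y
      using R b by (intro bump_D1_bounded) auto
    show "\<bar>bump_D1 (R\<^sup>2) b (y + h *\<^sub>R b) - bump_D1 (R\<^sup>2) b y\<bar>
        \<le> (8 * (R\<^sup>2) ^ 3 + 48 * (R * (R * (R\<^sup>2) ^ 2))) * \<bar>h\<bar>" for y h
      by (rule line_lipschitz[where v' = "bump_D2 (R\<^sup>2) b b"],
          rule has_real_derivative_bump_D1, rule bump_D2_bounded) (use R b in auto)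
    show "AE y in lborel. ((\<lambda>t. bump_D1 (R\<^sup>2) b (y + t *\<^sub>R b)) has_real_derivative bump_D2 (R\<^sup>2) b b y) (at 0)"
      by (intro AE_I2 has_real_derivative_bump_D1)
    show "bump_D1 (R\<^sup>2) b y = 0" if "R \<le> norm y" for y
      using that R by (simp add: bump_D1_def bump_eq_0)
    show "integrable lborel (indicator (ball (0::'a) (R + 1)) :: 'a \<Rightarrow> real)"
      by (intro integrable_real_indicator) (auto simp: emeasure_lborel_ball_finite[unfolded infinity_ennreal_def])
    show "((\<lambda>t. indicator (ball 0 (R + 1)) (y + t *\<^sub>R b)) has_real_derivative 0) (at 0)"
      if "norm y < R + 1" for y :: 'a
      using has_real_derivative_line_cong[of "ball 0 (R + 1)" y "indicator (ball 0 (R + 1))" "\<lambda>_. 1" b 0] that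
      by simp
  qed (use R b in auto)
  moreover have "bump_D2 (R\<^sup>2) b b z * indicator (ball 0 (R + 1)) z = bump_D2 (R\<^sup>2) b b z" for z
    using bump_eq_0[of R z] R by (auto simp: indicator_def bump_D2_def)
  ultimately show ?thesis by simp
qed

text \<open>Writing \<open>|z|^2\<close> as \<open>c - (c - |z|^2)\<close> turns the Laplacian of
  the kernel into a combination of kernels of the same family, so ball averages determine its
  integral against w.\<close>

lemma sum_bump_D2:
  "(\<Sum>b\<in>Basis. bump_D2 c b b (z::'a::euclidean_space))
    = 48 * c * bump c 2 z - (8 * DIM('a) + 48) * bump c 3 z"
proof -
  have B3: "bump c 3 z = (c - z \<bullet> z) * bump c 2 z"
    using bump_Suc[of c 2 z] by (simp add: numeral_eq_Suc)
  have "(\<Sum>b\<in>Basis. bump_D2 c b b z) = (\<Sum>b\<in>(Basis::'a set). - 8 * bump c 3 z + 48 * bump c 2 z * ((z \<bullet> b) * (z \<bullet> b)))"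
    by (intro sum.cong) (auto simp: bump_D2_def algebra_simps)
  also have "\<dots> = - 8 * DIM('a) * bump c 3 z + 48 * bump c 2 z * (z \<bullet> z)"
    unfolding sum.distrib sum_distrib_left[symmetric] euclidean_inner[of z z, symmetric] by simp
  finally show ?thesis unfolding B3 by (simp add: algebra_simps)
qed

text \<open>The averaged function w is kept apart from f. Nothing is assumed about the regularity of
  f, and w can absorb both the factor K and a change on a null set.\<close>

lemma mean_value_imp_harmonic:
  fixes f w :: "'a::euclidean_space \<Rightarrow> real"
  assumes w: "integrable lborel w" and R: "0 < R" and S: "open S"
    and ball: "\<And>x r. x \<in> S \<Longrightarrow> 0 < r \<Longrightarrow> r \<le> R \<Longrightarrow>
      (\<integral>y. indicator (ball x r) y * w y \<partial>lborel) = f x * measure lborel (ball x r)"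
  shows "harmonic_fun_on S f"
proof -
  \<comment> \<open>Dividing by the total mass of the kernel makes the convolution reproduce f on
    S.\<close>
  define C where "C = (\<integral>z. bump (R\<^sup>2) 4 (z::'a) \<partial>lborel)"
  have C: "C > 0" unfolding C_def by (rule integral_bump_pos[OF R])
  define v where "v y = w y / C" for y
  have v: "integrable lborel v" unfolding v_def using w by simp
  \<comment> \<open>Exponent 4 gives the representation of f; exponents 2 and 3 evaluate its
    Laplacian.\<close>
  have mean: "(\<integral>y. bump (R\<^sup>2) p (y - x) * v y \<partial>lborel) = f x / C * (\<integral>z. bump (R\<^sup>2) p (z::'a) \<partial>lborel)"
    if "x \<in> S" for p x
  proof -
    have "(\<integral>y. bump (R\<^sup>2) p (y - x) * w y \<partial>lborel) = f x * (\<integral>z. bump (R\<^sup>2) p (z::'a) \<partial>lborel)"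
      by (rule integral_bump_eq_mean[OF w R]) (use ball that in auto)
    then show ?thesis by (simp add: v_def)
  qed
  define F where "F x = (\<integral>y. bump (R\<^sup>2) 4 (y - x) * v y \<partial>lborel)" for x
  have F: "f x = F x" if "x \<in> S" for x
    using mean[OF that, of 4] C by (simp add: F_def C_def)
  note conv1 = C1_fun_on_convolution[OF continuous_on_bump_numeral bump_bounded has_real_derivative_bump_4
      continuous_on_bump_D1 bump_D1_bounded v]
  have pd: "partial_deriv b F = (\<lambda>x. \<integral>y. - bump_D1 (R\<^sup>2) b (y - x) * v y \<partial>lborel)" if "b \<in> Basis" for b
    unfolding F_def[abs_def] using conv1(2)[of R] that R by simp
  have C1: "C1_fun_on UNIV F" unfolding F_def[abs_def] using conv1(1)[of R] R by simp
  have bd1: "\<bar>- bump_D1 (R\<^sup>2) b z\<bar> \<le> 8 * (R * (R\<^sup>2) ^ 3)" if "b \<in> Basis" for b z :: 'a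
    using bump_D1_bounded[of R b z] R that by simp
  have bd2: "\<bar>- bump_D2 (R\<^sup>2) b b' z\<bar> \<le> 8 * (R\<^sup>2) ^ 3 + 48 * (R * (R * (R\<^sup>2) ^ 2))"
    if "b \<in> Basis" "b' \<in> Basis" for b b' z :: 'a
    using bump_D2_bounded[of R b b' z] R that by simp
  \<comment> \<open>The first derivatives of F have kernel \<open>- bump_D1\<close>; the second
    application brings another minus sign and the two cancel.\<close>
  note conv2 = C1_fun_on_convolution[OF continuous_on_minus[OF continuous_on_bump_D1] bd1
      DERIV_minus[OF has_real_derivative_bump_D1] continuous_on_minus[OF continuous_on_bump_D2] bd2 v]
  have pd2: "partial_deriv b (partial_deriv b F) x = (\<integral>y. bump_D2 (R\<^sup>2) b b (y - x) * v y \<partial>lborel)"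
    if "b \<in> Basis" for b x
    using conv2(2)[of b b] that by (simp add: pd)
  have C2: "C1_fun_on UNIV (partial_deriv b F)" if "b \<in> Basis" for b
    using conv2(1)[of b] that by (simp add: pd)
  have intD2: "integrable lborel (\<lambda>y. bump_D2 (R\<^sup>2) b b (y - x) * v y)" if "b \<in> Basis" for b x
  proof (rule integrable_bounded_mult[OF _ bump_D2_bounded v])
    have [measurable]: "bump_D2 (R\<^sup>2) b b \<in> borel_measurable borel"
      by (auto intro: borel_measurable_continuous_onI continuous_on_bump_D2)
    show "(\<lambda>y. bump_D2 (R\<^sup>2) b b (y - x)) \<in> borel_measurable lborel" by measurable
  qed (use R that in auto)
  have intb: "integrable lborel (\<lambda>y. bump (R\<^sup>2) p (y - x) * v y)" for p x
    by (rule integrable_bounded_mult[OF _ bump_bounded v]) auto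
  have intb1: "integrable lborel (bump (R\<^sup>2) p :: 'a \<Rightarrow> real)" for p
    by (rule integrable_bump) (use R in simp)
  have intD2': "integrable lborel (bump_D2 (R\<^sup>2) b b)" if "b \<in> Basis" for b :: 'a
  proof -
    have [measurable]: "bump_D2 (R\<^sup>2) b b \<in> borel_measurable borel"
      by (auto intro: borel_measurable_continuous_onI continuous_on_bump_D2)
    have "integrable lborel (\<lambda>z. bump_D2 (R\<^sup>2) b b z * indicator (ball 0 R) z)"
      by (rule integrable_bounded_mult[OF _ bump_D2_bounded])
        (use R that in \<open>auto intro!: integrable_real_indicator simp: emeasure_lborel_ball_finite[unfolded infinity_ennreal_def]\<close>)
    moreover have "bump_D2 (R\<^sup>2) b b z * indicator (ball 0 R) z = bump_D2 (R\<^sup>2) b b z" for z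
      using bump_eq_0[of R z] R by (auto simp: indicator_def bump_D2_def)
    ultimately show ?thesis by simp
  qed
  have lap: "laplacian F x = 0" if x: "x \<in> S" for x
  proof -
    define \<alpha> \<beta> where "\<alpha> = 48 * R\<^sup>2" and "\<beta> = 8 * real DIM('a) + 48"
    have sumD2: "(\<Sum>b\<in>Basis. bump_D2 (R\<^sup>2) b b (z::'a)) = \<alpha> * bump (R\<^sup>2) 2 z - \<beta> * bump (R\<^sup>2) 3 z" for z
      by (simp add: sum_bump_D2 \<alpha>_def \<beta>_def)
    have "laplacian F x = (\<integral>y. (\<Sum>b\<in>Basis. bump_D2 (R\<^sup>2) b b (y - x) * v y) \<partial>lborel)"
      unfolding laplacian_def using intD2 by (simp add: pd2)
    also have "\<dots> = (\<integral>y. \<alpha> * (bump (R\<^sup>2) 2 (y - x) * v y) - \<beta> * (bump (R\<^sup>2) 3 (y - x) * v y) \<partial>lborel)"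
      unfolding sum_distrib_right[symmetric] sumD2 by (simp add: algebra_simps)
    also have "\<dots> = \<alpha> * (\<integral>y. bump (R\<^sup>2) 2 (y - x) * v y \<partial>lborel)
        - \<beta> * (\<integral>y. bump (R\<^sup>2) 3 (y - x) * v y \<partial>lborel)"
      using intb by simp
    \<comment> \<open>Both kernels are radial, so the averages of v pull out the same factor
      \<open>f x / C\<close>; what remains is the integral of the Laplacian of the kernel.\<close>
    also have "\<dots> = f x / C * (\<alpha> * (\<integral>z. bump (R\<^sup>2) 2 (z::'a) \<partial>lborel) - \<beta> * (\<integral>z. bump (R\<^sup>2) 3 (z::'a) \<partial>lborel))"
      unfolding mean[OF x] by (simp only: right_diff_distrib mult_ac)
    also have "\<alpha> * (\<integral>z. bump (R\<^sup>2) 2 (z::'a) \<partial>lborel) - \<beta> * (\<integral>z. bump (R\<^sup>2) 3 (z::'a) \<partial>lborel)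
        = (\<integral>z. (\<Sum>b\<in>Basis. bump_D2 (R\<^sup>2) b b (z::'a)) \<partial>lborel)"
      unfolding sumD2 using intb1 by simp
    also have "\<dots> = (\<Sum>b\<in>Basis. \<integral>z. bump_D2 (R\<^sup>2) b b (z::'a) \<partial>lborel)"
      by (rule Bochner_Integration.integral_sum[OF intD2'])
    also have "\<dots> = 0"
      by (intro sum.neutral ballI integral_bump_D2_eq_0[OF R])
    finally show ?thesis by simp
  qed
  have "harmonic_fun_on S F"
    unfolding harmonic_fun_on_def C2_fun_on_def
  proof (intro conjI ballI)
    show "C1_fun_on S F" by (rule C1_fun_on_subset[OF C1]) simp
    show "C1_fun_on S (partial_deriv b F)" if "b \<in> Basis" for b
      by (rule C1_fun_on_subset[OF C2[OF that]]) simp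
  qed (rule lap)
  then show ?thesis
    using harmonic_fun_on_cong[of S f F] S F by blast
qed

section \<open>From harmonicity to the mean value property\<close>

text \<open>Walk from x to \<open>x + h\<close> one coordinate at a time and apply the mean value
  estimate to each leg. The legs stay in the ball because every coordinate of the displacement is
  dominated by that of h.\<close>

lemma telescope_coordinates:
  fixes g :: "'a::euclidean_space \<Rightarrow> real"
  assumes der: "\<And>b y. b \<in> Basis \<Longrightarrow> y \<in> ball x e \<Longrightarrow> ((\<lambda>t. g (y + t *\<^sub>R b)) has_real_derivative g' b y) (at 0)"
    and bd: "\<And>b y. b \<in> Basis \<Longrightarrow> y \<in> ball x e \<Longrightarrow> \<bar>g' b y\<bar> \<le> L"
    and h: "norm h < e" and S: "S \<subseteq> Basis"
  shows "\<bar>g (x + (\<Sum>b\<in>S. (h \<bullet> b) *\<^sub>R b)) - g x\<bar> \<le> L * (\<Sum>b\<in>S. \<bar>h \<bullet> b\<bar>)"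
  using finite_subset[OF S finite_Basis] S
proof (induction S rule: finite_induct)
  case empty
  then show ?case by simp
next
  case (insert b S)
  define p where "p = (\<Sum>b\<in>S. (h \<bullet> b) *\<^sub>R b)"
  have b: "b \<in> Basis" and S: "S \<subseteq> Basis" using insert by auto
  have mem: "x + p + t *\<^sub>R b \<in> ball x e" if t: "\<bar>t\<bar> \<le> \<bar>h \<bullet> b\<bar>" for t
  proof -
    have "norm (p + t *\<^sub>R b) \<le> norm h"
    proof (rule norm_le_componentwise)
      fix i :: 'a assume i: "i \<in> Basis"
      have "p \<bullet> i = (\<Sum>b\<in>S. if b = i then h \<bullet> i else 0)"
        unfolding p_def inner_sum_left using S i
        by (intro sum.cong refl) (auto simp: inner_Basis)
      also have "\<dots> = (if i \<in> S then h \<bullet> i else 0)"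
        using insert.hyps by simp
      finally show "\<bar>(p + t *\<^sub>R b) \<bullet> i\<bar> \<le> \<bar>h \<bullet> i\<bar>"
        using t i b insert.hyps by (auto simp: inner_add_left inner_Basis)
    qed
    then have "dist (x + p + t *\<^sub>R b) x < e" using h by (simp add: dist_norm add.assoc)
    then show ?thesis by (simp add: dist_commute)
  qed
  have "\<bar>g (x + p + (h \<bullet> b) *\<^sub>R b) - g (x + p)\<bar> \<le> L * \<bar>h \<bullet> b\<bar>"
    by (rule line_lipschitz[where v' = "g' b"]) (use mem der bd b in auto)
  moreover have "\<bar>g (x + p) - g x\<bar> \<le> L * (\<Sum>b\<in>S. \<bar>h \<bullet> b\<bar>)"
    using insert.IH S by (simp add: p_def)
  moreover have 1: "x + (\<Sum>b\<in>insert b S. (h \<bullet> b) *\<^sub>R b) = x + p + (h \<bullet> b) *\<^sub>R b"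
    using insert.hyps by (simp add: p_def add_ac)
  moreover have 2: "L * (\<Sum>b\<in>insert b S. \<bar>h \<bullet> b\<bar>) = L * \<bar>h \<bullet> b\<bar> + L * (\<Sum>b\<in>S. \<bar>h \<bullet> b\<bar>)"
    using insert.hyps by (simp add: distrib_left)
  ultimately show ?case unfolding 1 2 by linarith
qed

text \<open>Harmonicity provides derivatives along the coordinate axes, whereas the mean over a
  growing ball moves its points along rays. Total differentiability supplies the chain rule for the
  latter.\<close>

lemma C1_fun_on_has_derivative:
  fixes f :: "'a::euclidean_space \<Rightarrow> real"
  assumes f: "C1_fun_on D f" and D: "open D" and x: "x \<in> D"
  shows "(f has_derivative (\<lambda>h. \<Sum>b\<in>Basis. (h \<bullet> b) * partial_deriv b f x)) (at x)"
  unfolding has_derivative_at_alt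
proof (intro conjI allI impI)
  show "bounded_linear (\<lambda>h. \<Sum>b\<in>Basis. (h \<bullet> b) * partial_deriv b f x)"
    by (intro bounded_linear_sum bounded_linear_mult_const bounded_linear_inner_left)
  fix \<epsilon> :: real assume "0 < \<epsilon>"
  \<comment> \<open>The absolute values of the coordinates of a vector sum to at most
    \<open>DIM('a)\<close> times its norm.\<close>
  define \<eta> where "\<eta> = \<epsilon> / DIM('a)"
  have \<eta>: "0 < \<eta>" using \<open>0 < \<epsilon>\<close> by (simp add: \<eta>_def)
  have "\<forall>b\<in>Basis. \<exists>d>0. \<forall>y. dist y x < d \<longrightarrow> y \<in> D \<and> \<bar>partial_deriv b f y - partial_deriv b f x\<bar> < \<eta>"
  proof
    fix b :: 'a assume b: "b \<in> Basis"
    have "isCont (partial_deriv b f) x"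
      using f b D x continuous_on_eq_continuous_at unfolding C1_fun_on_def by blast
    then obtain d1 where "d1 > 0" "\<And>y. dist y x < d1 \<Longrightarrow> \<bar>partial_deriv b f y - partial_deriv b f x\<bar> < \<eta>"
      using \<eta> unfolding continuous_at_eps_delta dist_real_def by blast
    moreover obtain d2 where "d2 > 0" "\<And>y. dist y x < d2 \<Longrightarrow> y \<in> D"
      using D x unfolding open_dist by blast
    ultimately show "\<exists>d>0. \<forall>y. dist y x < d \<longrightarrow> y \<in> D \<and> \<bar>partial_deriv b f y - partial_deriv b f x\<bar> < \<eta>"
      by (intro exI[of _ "min d1 d2"]) auto
  qed
  then obtain d where d: "\<And>b. b \<in> Basis \<Longrightarrow> 0 < d b"
    "\<And>b y. b \<in> Basis \<Longrightarrow> dist y x < d b \<Longrightarrow> y \<in> D \<and> \<bar>partial_deriv b f y - partial_deriv b f x\<bar> < \<eta>"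
    by metis
  define e where "e = Min (d ` Basis)"
  have e: "0 < e" and le: "\<And>b. b \<in> Basis \<Longrightarrow> e \<le> d b"
    using d(1) by (auto simp: e_def)
  \<comment> \<open>Subtracting the candidate derivative leaves a function whose partial derivatives
    are at most \<open>\<eta>\<close> near x, so the coordinate walk bounds its increment.\<close>
  define g where "g y = f y - (\<Sum>b\<in>Basis. ((y - x) \<bullet> b) * partial_deriv b f x)" for y
  have mem: "y \<in> D \<and> \<bar>partial_deriv b f y - partial_deriv b f x\<bar> \<le> \<eta>"
    if "b \<in> Basis" "y \<in> ball x e" for b y
    using d(2)[of b y] le[of b] that by (auto simp: dist_commute intro: less_imp_le)
  have gder: "((\<lambda>t. g (y + t *\<^sub>R b)) has_real_derivative partial_deriv b f y - partial_deriv b f x) (at 0)"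
    if b: "b \<in> Basis" and y: "y \<in> ball x e" for b y
  proof -
    have "(\<Sum>i\<in>Basis. (b \<bullet> i) * partial_deriv i f x) = (\<Sum>i\<in>Basis. if i = b then partial_deriv b f x else 0)"
      using b by (intro sum.cong refl) (auto simp: inner_Basis)
    then have s: "(\<Sum>i\<in>Basis. (b \<bullet> i) * partial_deriv i f x) = partial_deriv b f x"
      using b by simp
    have "g (y + t *\<^sub>R b) = f (y + t *\<^sub>R b) - ((\<Sum>i\<in>Basis. ((y - x) \<bullet> i) * partial_deriv i f x) + t * partial_deriv b f x)" for t
      unfolding g_def s[symmetric]
      by (simp add: inner_add_left inner_diff_left sum.distrib sum_distrib_left algebra_simps sum_subtractf)
    then show ?thesis
      using has_real_derivative_partial_deriv[OF f, of y b] mem[OF b y] b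
      by (auto intro!: derivative_eq_intros)
  qed
  show "\<exists>d>0. \<forall>y. norm (y - x) < d \<longrightarrow>
      norm (f y - f x - (\<Sum>b\<in>Basis. ((y - x) \<bullet> b) * partial_deriv b f x)) \<le> \<epsilon> * norm (y - x)"
  proof (intro exI[of _ e] conjI allI impI e)
    fix y assume y: "norm (y - x) < e"
    have "\<bar>g (x + (\<Sum>b\<in>Basis. ((y - x) \<bullet> b) *\<^sub>R b)) - g x\<bar> \<le> \<eta> * (\<Sum>b\<in>Basis. \<bar>(y - x) \<bullet> b\<bar>)"
      by (rule telescope_coordinates[where e = e and g' = "\<lambda>b y. partial_deriv b f y - partial_deriv b f x"])
        (use gder mem y in auto)
    also have "(\<Sum>b\<in>Basis. \<bar>(y - x) \<bullet> b\<bar>) \<le> (\<Sum>b\<in>(Basis::'a set). norm (y - x))"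
      by (intro sum_mono Basis_le_norm)
    also have "\<eta> * (\<Sum>b\<in>(Basis::'a set). norm (y - x)) = \<epsilon> * norm (y - x)"
      by (simp add: \<eta>_def)
    finally show "norm (f y - f x - (\<Sum>b\<in>Basis. ((y - x) \<bullet> b) * partial_deriv b f x)) \<le> \<epsilon> * norm (y - x)"
      using \<eta> by (simp add: euclidean_representation g_def mult_left_mono)
  qed
qed

lemma C1_fun_on_continuous_on:
  assumes "C1_fun_on D f" "open D"
  shows "continuous_on D f"
  using C1_fun_on_has_derivative[OF assms] has_derivative_continuous
  by (blast intro: continuous_at_imp_continuous_on)

section \<open>The mean over a ball as a function of its radius\<close>

lemma integrable_indicator_bounded:
  fixes g :: "'a::euclidean_space \<Rightarrow> real"
  assumes g: "continuous_on (cball c r) g" and S: "S \<subseteq> cball c r" "S \<in> sets borel"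
  shows "integrable lborel (\<lambda>y. indicator S y * g y)"
proof -
  have "set_integrable lborel (cball c r) g"
    unfolding set_integrable_def by (rule borel_integrable_compact) (use g in auto)
  then have "set_integrable lborel S g"
    by (rule set_integrable_subset) (use S in auto)
  then show ?thesis by (simp add: set_integrable_def)
qed

text \<open>Moves the radius from the domain of integration into the integrand, where it can be
  differentiated.\<close>

lemma integral_ball_rescale:
  fixes f :: "'a::euclidean_space \<Rightarrow> real"
  assumes f: "(\<lambda>y. indicator (ball x r) y * f y) \<in> borel_measurable borel" and r: "0 < r"
  shows "(\<integral>y. indicator (ball x r) y * f y \<partial>lborel)
    = r ^ DIM('a) * (\<integral>z. indicator (ball 0 1) z * f (x + r *\<^sub>R z) \<partial>lborel)"
proof -
  have "(\<integral>y. indicator (ball x r) y * f y \<partial>lborel)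
      = (\<integral>y. indicator (ball x r) y * f y \<partial>density (distr lborel borel (\<lambda>z. x + r *\<^sub>R z)) (\<lambda>_. \<bar>r\<bar> ^ DIM('a)))"
    using lborel_affine[of r x] r by simp
  also have "\<dots> = (\<integral>y. r ^ DIM('a) * (indicator (ball x r) y * f y) \<partial>distr lborel borel (\<lambda>z. x + r *\<^sub>R z))"
    using f r by (subst integral_density) auto
  also have "\<dots> = (\<integral>z. r ^ DIM('a) * (indicator (ball x r) (x + r *\<^sub>R z) * f (x + r *\<^sub>R z)) \<partial>lborel)"
    using f by (subst integral_distr) auto
  also have "(\<lambda>z. indicator (ball x r) (x + r *\<^sub>R z) :: real) = indicator (ball 0 1)"
    using r by (auto simp: indicator_def dist_norm)
  finally show ?thesis by simp
qed

text \<open>Because of the corner on the sphere the mean value estimate along lines does not apply.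
  Truncating the norm at R instead gives \<open>R^2 - m^2\<close> with m Lipschitz with constant 1
  and at most R.\<close>

lemma bump_1_lipschitz:
  assumes "0 \<le> R"
  shows "\<bar>bump (R\<^sup>2) 1 y - bump (R\<^sup>2) 1 z\<bar> \<le> 2 * R * norm (y - z)"
proof -
  define m where "m z = min (norm z) R" for z :: 'a
  have eq: "bump (R\<^sup>2) 1 z = R\<^sup>2 - (m z)\<^sup>2" for z
  proof (cases "norm z < R")
    case True
    then have "(norm z)\<^sup>2 < R\<^sup>2" by (intro power_strict_mono) auto
    then show ?thesis using True
      by (simp add: bump_def pos_power_def m_def dot_square_norm)
  next
    case False
    then show ?thesis using assms by (simp add: bump_eq_0 m_def min_def)
  qed
  have "\<bar>bump (R\<^sup>2) 1 y - bump (R\<^sup>2) 1 z\<bar> = \<bar>m z - m y\<bar> * (m z + m y)"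
  proof -
    have "R\<^sup>2 - (m y)\<^sup>2 - (R\<^sup>2 - (m z)\<^sup>2) = (m z - m y) * (m z + m y)"
      by (simp add: power2_eq_square algebra_simps)
    moreover have "0 \<le> m z + m y" using assms by (simp add: m_def)
    ultimately show ?thesis unfolding eq by (simp only: abs_mult abs_of_nonneg)
  qed
  also have "\<dots> \<le> norm (y - z) * (2 * R)"
  proof (intro mult_mono)
    show "\<bar>m z - m y\<bar> \<le> norm (y - z)"
      using norm_triangle_ineq3[of y z] by (auto simp: m_def)
  qed (use assms in \<open>auto simp: m_def\<close>)
  finally show ?thesis by (simp add: mult_ac)
qed

text \<open>Integration by parts against \<open>1 - |z|\<^sup>2\<close>, whose gradient on the unit ball is \<open>- 2 z\<close>, turns
  the derivative of the mean over the ball of radius \<open>t\<close> into an integral of the Laplacian.\<close>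

lemma harmonic_imp_mean_value:
  fixes f :: "'a::euclidean_space \<Rightarrow> real"
  assumes f: "harmonic_fun_on D f" and D: "open D" and r: "0 < r" and sub: "cball x r \<subseteq> D"
  shows "(\<integral>y. indicator (ball x r) y * f y \<partial>lborel) = f x * (measure lborel (ball (0::'a) 1) * r ^ DIM('a))"
proof -
  have C1: "C1_fun_on D f" and C1': "\<And>b. b \<in> Basis \<Longrightarrow> C1_fun_on D (partial_deriv b f)"
    and lap: "\<And>y. y \<in> D \<Longrightarrow> laplacian f y = 0"
    using f by (auto simp: harmonic_fun_on_def C2_fun_on_def)
  have cf: "continuous_on D f" by (rule C1_fun_on_continuous_on[OF C1 D])
  have cpf: "continuous_on D (partial_deriv b f)" if "b \<in> Basis" for b
    using C1 that by (simp add: C1_fun_on_def)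
  have cppf: "continuous_on D (partial_deriv b (partial_deriv b f))" if "b \<in> Basis" for b
    using C1'[OF that] that by (simp add: C1_fun_on_def)
  have bounded: "\<exists>B. \<forall>y\<in>cball x r. \<bar>g y\<bar> \<le> B" if "continuous_on D g" for g :: "'a \<Rightarrow> real"
  proof -
    have "compact (g ` cball x r)"
      by (rule compact_continuous_image[OF continuous_on_subset[OF that sub]]) auto
    then show ?thesis using compact_imp_bounded bounded_iff by (metis imageI real_norm_def)
  qed
  obtain B0 where B0: "\<And>y. y \<in> cball x r \<Longrightarrow> \<bar>f y\<bar> \<le> B0" using bounded[OF cf] by blast
  have "\<forall>b\<in>Basis. \<exists>B. \<forall>y\<in>cball x r. \<bar>partial_deriv b f y\<bar> \<le> B" using bounded cpf by blast
  then obtain B1 where B1: "\<And>b y. b \<in> Basis \<Longrightarrow> y \<in> cball x r \<Longrightarrow> \<bar>partial_deriv b f y\<bar> \<le> B1 b" by metis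
  have cont_scaled: "continuous_on (cball 0 \<rho>) (\<lambda>z. g (x + t *\<^sub>R z))"
    if "continuous_on D g" "0 \<le> t" "t * \<rho> \<le> r" for g :: "'a \<Rightarrow> real" and t \<rho>
  proof (rule continuous_on_compose2[OF that(1)])
    show "(\<lambda>z. x + t *\<^sub>R z) ` cball 0 \<rho> \<subseteq> D"
    proof safe
      fix z :: 'a assume "z \<in> cball 0 \<rho>"
      then have "t * norm z \<le> t * \<rho>" using that(2) by (intro mult_left_mono) auto
      then show "x + t *\<^sub>R z \<in> D" using that sub by (intro subsetD[OF sub]) (simp add: dist_norm)
    qed
  qed (intro continuous_intros)
  \<comment> \<open>Up to the volume of the unit ball this is the mean over the ball of radius t. On
    the fixed unit ball it is defined at \<open>t = 0\<close> as well, where it is f x times that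
    volume.\<close>
  define M where "M t = (\<integral>z. indicator (ball 0 1) z * f (x + t *\<^sub>R z) \<partial>lborel)" for t
  have mem: "x + t *\<^sub>R z \<in> cball x r" if "0 \<le> t" "t \<le> r" "z \<in> ball 0 1" for t z
  proof -
    have "t * norm z \<le> r * 1" using that by (intro mult_mono) auto
    then show ?thesis using that by (simp add: dist_norm)
  qed
  have intf: "integrable lborel (\<lambda>z. indicator (ball 0 1) z * f (x + t *\<^sub>R z))" if "0 \<le> t" "t \<le> r" for t
    by (rule integrable_indicator_bounded[where c = 0 and r = 1]) (use that cf in \<open>auto intro!: cont_scaled\<close>)
  have ind_int: "integrable lborel (indicator (ball 0 1) :: 'a \<Rightarrow> real)"
    by (intro integrable_real_indicator) (auto simp: emeasure_lborel_ball_finite[unfolded infinity_ennreal_def])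
  have cM: "continuous_on {0..r} M"
    unfolding M_def
  proof (rule continuous_on_integral_bounded_kernel[where w = "\<lambda>z. B0 * indicator (ball 0 1) z"])
    show "\<bar>indicator (ball 0 1) z * f (x + t *\<^sub>R z)\<bar> \<le> B0 * indicator (ball 0 1) z" if "t \<in> {0..r}" for t z
      using B0[OF mem[of t z]] that by (auto simp: indicator_def)
    show "continuous_on {0..r} (\<lambda>t. indicator (ball 0 1) z * f (x + t *\<^sub>R z))" for z
    proof (cases "z \<in> ball 0 1")
      case True
      show ?thesis
        by (intro continuous_intros continuous_on_compose2[OF cf]) (use mem sub True in force)
    qed simp
  qed (use intf ind_int borel_measurable_integrable in auto)
  \<comment> \<open>Only \<open>cball x r\<close> is known to lie in D, so the derivative is taken
    at interior radii; continuity on \<open>{0..r}\<close> takes care of the end points.\<close>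
  have derM: "(M has_real_derivative 0) (at t)" if t: "0 < t" "t < r" for t
  proof -
    \<comment> \<open>The radius \<open>r / t\<close> is the largest whose scaled ball fits into
      \<open>ball x r\<close>. It exceeds 1, which gives the margin beyond the support of the kernel
      that integration by parts asks for.\<close>
    define V where "V b z = indicator (ball 0 (r / t)) z * partial_deriv b f (x + t *\<^sub>R z)" for b z
    define V' where "V' b z = indicator (ball 0 (r / t)) z * (t * partial_deriv b (partial_deriv b f) (x + t *\<^sub>R z))" for b z
    have rt: "1 < r / t" "t * (r / t) = r" using t by auto
    have memD: "x + t *\<^sub>R z \<in> cball x r" "x + t *\<^sub>R z \<in> D" if "z \<in> ball 0 (r / t)" for z
    proof -
      have "t * norm z \<le> t * (r / t)" using that t by (intro mult_left_mono) auto
      then show "x + t *\<^sub>R z \<in> cball x r" using t by (simp add: dist_norm)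
      then show "x + t *\<^sub>R z \<in> D" using sub by blast
    qed
    have intV: "integrable lborel (V b)" if "b \<in> Basis" for b
      unfolding V_def
      by (rule integrable_indicator_bounded[where c = 0 and r = "r / t"])
        (use t that cpf in \<open>auto intro!: cont_scaled\<close>)
    have intV': "integrable lborel (V' b)" if "b \<in> Basis" for b
      unfolding V'_def
      by (rule integrable_indicator_bounded[where c = 0 and r = "r / t"])
        (use t that cppf in \<open>auto intro!: cont_scaled continuous_intros\<close>)
    have parts: "(\<integral>z. - 2 * (z \<bullet> b) * bump (1\<^sup>2) 0 z * V b z \<partial>lborel) = - (\<integral>z. bump (1\<^sup>2) 1 z * V' b z \<partial>lborel)"
      if b: "b \<in> Basis" for b
    proof -
      obtain B where B: "\<And>y. y \<in> cball x r \<Longrightarrow> \<bar>partial_deriv b (partial_deriv b f) y\<bar> \<le> B"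
        using bounded[OF cppf[OF b]] by blast
      show ?thesis
      proof (rule integral_by_parts_direction[where \<rho> = 1 and \<rho>' = "r / t" and L' = "t * B" and b = b])
        show "\<bar>bump (1\<^sup>2) 1 (y + h *\<^sub>R b) - bump (1\<^sup>2) 1 y\<bar> \<le> 2 * \<bar>h\<bar>" for y h
          using bump_1_lipschitz[of 1 "y + h *\<^sub>R b" y] b by simp
        show "AE z in lborel. ((\<lambda>s. bump (1\<^sup>2) 1 (z + s *\<^sub>R b)) has_real_derivative - 2 * (z \<bullet> b) * bump (1\<^sup>2) 0 z) (at 0)"
          using AE_lborel_sphere[of "1\<^sup>2" 0]
        proof eventually_elim
          case (elim z)
          then show ?case using has_real_derivative_bump[of "1\<^sup>2" z 0 b] by simp
        qed
        show "V' b \<in> borel_measurable borel" using intV'[OF b] borel_measurable_integrable by fastforce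
        show "((\<lambda>s. V b (z + s *\<^sub>R b)) has_real_derivative V' b z) (at 0)" if z: "norm z < r / t" for z
        proof -
          have zb: "z \<in> ball 0 (r / t)" using z by simp
          have "((\<lambda>s. partial_deriv b f (x + t *\<^sub>R z + s *\<^sub>R b)) \<circ> (\<lambda>s. t * s) has_real_derivative
              partial_deriv b (partial_deriv b f) (x + t *\<^sub>R z) * t) (at 0)"
            by (rule DERIV_chain)
              (use has_real_derivative_partial_deriv[OF C1'[OF b] memD(2)[OF zb] b] in
                \<open>auto intro!: derivative_eq_intros\<close>)
          then have "((\<lambda>s. partial_deriv b f (x + t *\<^sub>R (z + s *\<^sub>R b))) has_real_derivative V' b z) (at 0)"
            using zb by (simp add: comp_def V'_def algebra_simps)
          then show ?thesis
            using has_real_derivative_line_cong[of "ball 0 (r / t)" z "V b" "\<lambda>z. partial_deriv b f (x + t *\<^sub>R z)" b] zb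
            by (simp add: V_def)
        qed
        show "\<bar>V' b z\<bar> \<le> t * B" if "norm z < r / t" for z
          using B[OF memD(1)[of z]] that t by (simp add: V'_def abs_mult)
        show "\<bar>bump (1\<^sup>2) 1 y\<bar> \<le> 1" for y :: 'a using bump_bounded[of "1\<^sup>2" 1 y] by simp
        show "bump (1\<^sup>2) 1 y = 0" if "1 \<le> norm y" for y :: 'a using bump_eq_0[of 1 y] that by simp
      qed (use b rt intV in auto)
    qed
    \<comment> \<open>The derivative of f along the ray through z, restricted to the unit ball by
      the kernel of exponent 0.\<close>
    define G where "G z = (\<Sum>b\<in>Basis. (z \<bullet> b) * bump (1\<^sup>2) 0 z * V b z)" for z
    have intG: "integrable lborel (\<lambda>z. (z \<bullet> b) * bump (1\<^sup>2) 0 z * V b z)" if "b \<in> Basis" for b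
      by (rule integrable_bounded_mult[OF _ inner_mult_bump_bounded intV]) (use that in auto)
    have "(M has_real_derivative (\<integral>z. G z \<partial>lborel)) (at t)"
      unfolding M_def[abs_def]
    \<comment> \<open>This distance keeps the radius between 0 and r. There the sum of the bounds
      \<open>B1\<close> dominates the derivative along the ray, since the coordinates of z are at
      most 1 in absolute value.\<close>
    proof (rule has_real_derivative_integral_dominated[where d = "min t (r - t)"
          and L = "\<lambda>z. indicator (ball 0 1) z * (\<Sum>b\<in>Basis. B1 b)"])
      have fder: "((\<lambda>s. f (x + s *\<^sub>R z)) has_real_derivative (\<Sum>b\<in>Basis. (z \<bullet> b) * partial_deriv b f (x + s *\<^sub>R z))) (at s within T)"
        if "z \<in> ball 0 1" "0 \<le> s" "s \<le> r" for z s T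
      proof -
        have "x + s *\<^sub>R z \<in> D" using mem[of s z] that sub by blast
        then have "(f has_derivative (\<lambda>h. \<Sum>b\<in>Basis. (h \<bullet> b) * partial_deriv b f (x + s *\<^sub>R z))) (at (x + s *\<^sub>R z))"
          by (rule C1_fun_on_has_derivative[OF C1 D])
        moreover have "((\<lambda>s. x + s *\<^sub>R z) has_derivative (\<lambda>h. h *\<^sub>R z)) (at s within T)"
          by (auto intro!: derivative_eq_intros)
        ultimately have "((\<lambda>s. f (x + s *\<^sub>R z)) has_derivative (\<lambda>h. \<Sum>b\<in>Basis. ((h *\<^sub>R z) \<bullet> b) * partial_deriv b f (x + s *\<^sub>R z))) (at s within T)"
          by (rule has_derivative_compose[rotated])
        then show ?thesis
          unfolding has_field_derivative_def
          by (rule has_derivative_eq_rhs) (simp add: fun_eq_iff sum_distrib_left mult_ac)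
      qed
      show "AE z in lborel. ((\<lambda>s. indicator (ball 0 1) z * f (x + s *\<^sub>R z)) has_real_derivative G z) (at t)"
      proof (rule AE_I2)
        fix z :: 'a
        have b0: "bump (1\<^sup>2) 0 z = indicator (ball 0 1) z" by (rule bump_0_eq_indicator) simp
        show "((\<lambda>s. indicator (ball 0 1) z * f (x + s *\<^sub>R z)) has_real_derivative G z) (at t)"
        proof (cases "z \<in> ball 0 1")
          case True
          then have "z \<in> ball 0 (r / t)" using rt by simp
          then have "G z = (\<Sum>b\<in>Basis. (z \<bullet> b) * partial_deriv b f (x + t *\<^sub>R z))"
            using True unfolding G_def b0 V_def by simp
          then show ?thesis using fder[OF True, of t UNIV] t True by simp
        next
          case False
          then have "G z = 0" unfolding G_def b0 by simp
          then show ?thesis using False by simp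
        qed
      qed
      show "AE z in lborel. \<bar>indicator (ball 0 1) z * f (x + s *\<^sub>R z) - indicator (ball 0 1) z * f (x + t *\<^sub>R z)\<bar>
          \<le> indicator (ball 0 1) z * (\<Sum>b\<in>Basis. B1 b) * \<bar>s - t\<bar>" if s: "\<bar>s - t\<bar> < min t (r - t)" for s
      proof (rule AE_I2)
        fix z
        show "\<bar>indicator (ball 0 1) z * f (x + s *\<^sub>R z) - indicator (ball 0 1) z * f (x + t *\<^sub>R z)\<bar>
          \<le> indicator (ball 0 1) z * (\<Sum>b\<in>Basis. B1 b) * \<bar>s - t\<bar>"
        proof (cases "z \<in> ball 0 1")
          case True
          have "norm (f (x + s *\<^sub>R z) - f (x + t *\<^sub>R z)) \<le> (\<Sum>b\<in>Basis. B1 b) * norm (s - t)"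
          proof (rule field_differentiable_bound[where S = "{0..r}"])
            fix q assume q: "q \<in> {0..r}"
            show "((\<lambda>s. f (x + s *\<^sub>R z)) has_real_derivative (\<Sum>b\<in>Basis. (z \<bullet> b) * partial_deriv b f (x + q *\<^sub>R z))) (at q within {0..r})"
              using fder[OF True] q by simp
            have "\<bar>(z \<bullet> b) * partial_deriv b f (x + q *\<^sub>R z)\<bar> \<le> B1 b" if b: "b \<in> Basis" for b
            proof -
              have "\<bar>z \<bullet> b\<bar> * \<bar>partial_deriv b f (x + q *\<^sub>R z)\<bar> \<le> 1 * B1 b"
                using B1[OF b mem[of q z]] Basis_le_norm[OF b, of z] q True
                by (intro mult_mono) auto
              then show ?thesis by (simp add: abs_mult)
            qed
            then show "norm (\<Sum>b\<in>Basis. (z \<bullet> b) * partial_deriv b f (x + q *\<^sub>R z)) \<le> (\<Sum>b\<in>Basis. B1 b)"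
              by (intro sum_norm_le) simp
          qed (use s t in auto)
          then show ?thesis using True by simp
        qed simp
      qed
      show "integrable lborel (\<lambda>z. indicator (ball 0 1) z * f (x + s *\<^sub>R z))" if "\<bar>s - t\<bar> < min t (r - t)" for s
        using that by (intro intf) auto
      show "G \<in> borel_measurable lborel"
        unfolding G_def using intG by (intro borel_measurable_sum) (auto dest: borel_measurable_integrable)
    qed (use t ind_int in auto)
    moreover have "(\<integral>z. G z \<partial>lborel) = 0"
    proof -
      have "(\<integral>z. G z \<partial>lborel) = (\<Sum>b\<in>Basis. \<integral>z. (z \<bullet> b) * bump (1\<^sup>2) 0 z * V b z \<partial>lborel)"
        unfolding G_def using intG by (rule Bochner_Integration.integral_sum)
      also have "\<dots> = (\<Sum>b\<in>Basis. 1 / 2 * (\<integral>z. bump (1\<^sup>2) 1 z * V' b z \<partial>lborel))"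
      proof (rule sum.cong)
        fix b :: 'a assume b: "b \<in> Basis"
        have "- 2 * (\<integral>z. (z \<bullet> b) * bump (1\<^sup>2) 0 z * V b z \<partial>lborel)
            = (\<integral>z. - 2 * (z \<bullet> b) * bump (1\<^sup>2) 0 z * V b z \<partial>lborel)"
          by (simp only: mult.assoc integral_mult_right_zero)
        then show "(\<integral>z. (z \<bullet> b) * bump (1\<^sup>2) 0 z * V b z \<partial>lborel) = 1 / 2 * (\<integral>z. bump (1\<^sup>2) 1 z * V' b z \<partial>lborel)"
          unfolding parts[OF b] by linarith
      qed simp
      also have "\<dots> = 1 / 2 * (\<integral>z. (\<Sum>b\<in>Basis. bump (1\<^sup>2) 1 z * V' b z) \<partial>lborel)"
      proof -
        have "integrable lborel (\<lambda>z. bump (1\<^sup>2) 1 z * V' b z)" if "b \<in> Basis" for b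
          by (rule integrable_bounded_mult[OF _ bump_bounded intV']) (use that in auto)
        then show ?thesis
          by (subst Bochner_Integration.integral_sum) (auto simp: sum_distrib_left)
      qed
      \<comment> \<open>The inner derivative of \<open>x + t z\<close> contributes the factor t, so
        the sum over the coordinates is t times the Laplacian of f at a point of D.\<close>
      also have "(\<lambda>z. \<Sum>b\<in>Basis. bump (1\<^sup>2) 1 z * V' b z) = (\<lambda>z. 0)"
      proof
        fix z
        have "(\<Sum>b\<in>Basis. bump (1\<^sup>2) 1 z * V' b z)
          = bump (1\<^sup>2) 1 z * (indicator (ball 0 (r / t)) z * (t * laplacian f (x + t *\<^sub>R z)))"
          by (simp only: V'_def laplacian_def sum_distrib_left)
        also have "\<dots> = 0" using lap memD(2)[of z] by (auto simp: indicator_def)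
        finally show "(\<Sum>b\<in>Basis. bump (1\<^sup>2) 1 z * V' b z) = 0" .
      qed
      finally show ?thesis by simp
    qed
    ultimately show ?thesis by simp
  qed
  have "M r = M 0" by (rule DERIV_isconst_end[OF r cM]) (use derM in auto)
  also have "M 0 = f x * measure lborel (ball (0::'a) 1)"
    by (simp add: M_def mult.commute)
  finally have "M r = f x * measure lborel (ball (0::'a) 1)" .
  moreover have "(\<integral>y. indicator (ball x r) y * f y \<partial>lborel) = r ^ DIM('a) * M r"
    unfolding M_def
  proof (rule integral_ball_rescale[OF _ r])
    have "integrable lborel (\<lambda>y. indicator (ball x r) y * f y)"
      by (rule integrable_indicator_bounded) (use continuous_on_subset[OF cf sub] in auto)
    then show "(\<lambda>y. indicator (ball x r) y * f y) \<in> borel_measurable borel"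
      using borel_measurable_integrable by fastforce
  qed
  ultimately show ?thesis by simp
qed

section \<open>Quasinearly subharmonic functions\<close>

text \<open>Integrability makes both parts finite, so the subtraction never meets
  \<open>\<infinity> - \<infinity>\<close>.\<close>

lemma ereal_integral_eq_integral:
  assumes u: "\<And>x. x \<in> space M \<Longrightarrow> u x = ereal (g x)" and g: "integrable M g"
  shows "ereal_integral M u = ereal (integral\<^sup>L M g)"
proof -
  have fin: "(\<integral>\<^sup>+x. ennreal (h x) \<partial>M) < \<infinity>" if "integrable M h" for h :: "'a \<Rightarrow> real"
  proof -
    have "(\<integral>\<^sup>+x. ennreal (h x) \<partial>M) \<le> (\<integral>\<^sup>+x. ennreal (norm (h x)) \<partial>M)"
      by (intro nn_integral_mono ennreal_leI) simp
    also have "\<dots> < \<infinity>" using that by (simp add: integrable_iff_bounded)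
    finally show ?thesis .
  qed
  have eq: "enn2ereal A = ereal (enn2real A)" if "A < \<infinity>" for A
    using that by (cases A) (auto simp: enn2ereal_ennreal)
  have "(\<integral>\<^sup>+x. e2ennreal (u x) \<partial>M) = (\<integral>\<^sup>+x. ennreal (g x) \<partial>M)"
    by (rule nn_integral_cong) (simp add: u)
  moreover have "(\<integral>\<^sup>+x. e2ennreal (- u x) \<partial>M) = (\<integral>\<^sup>+x. ennreal (- g x) \<partial>M)"
    by (rule nn_integral_cong) (simp add: u)
  ultimately show ?thesis
    unfolding ereal_integral_def real_lebesgue_integral_def[OF g]
    using fin[OF g] fin[of "\<lambda>x. - g x"] g by (simp add: eq)
qed

lemma e2ennreal_abs_max: "e2ennreal \<bar>max (ereal a) 0\<bar> = ennreal (max a 0)"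
proof -
  have "\<bar>max (ereal a) 0\<bar> = ereal (max a 0)" by (simp add: max_def)
  then show ?thesis by (simp only: e2ennreal_ereal)
qed

lemma measure_lebesgue_ball: "measure lebesgue (ball c r) = measure lborel (ball c r)"
  by (simp add: measure_completion)

text \<open>The hypotheses are stable under negating f and u together, so one lemma covers both u
  and its negative.\<close>

lemma mean_value_imp_quasinearly_subharmonic_ns:
  fixes f :: "'a::euclidean_space \<Rightarrow> real"
  assumes D: "open D" and cf: "continuous_on D f" and u: "\<And>x. x \<in> D \<Longrightarrow> u x = ereal (f x)"
    and mean: "\<And>x r. 0 < r \<Longrightarrow> cball x r \<subseteq> D \<Longrightarrow>
      (\<integral>y. indicator (ball x r) y * f y \<partial>lborel) = f x * (measure lborel (ball (0::'a) 1) * r ^ DIM('a))"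
  shows "quasinearly_subharmonic_ns 1 D u"
  unfolding quasinearly_subharmonic_ns_def locally_integrable_on_def
proof (intro conjI allI ballI impI)
  have Dm: "D \<in> sets lebesgue" using D by simp
  have fm: "f \<in> borel_measurable (lebesgue_on D)"
    by (rule continuous_imp_measurable_on_sets_lebesgue[OF cf Dm])
  have "(\<lambda>x. ereal (f x)) \<in> borel_measurable (lebesgue_on D)" using fm by measurable
  then show um: "u \<in> borel_measurable (lebesgue_on D)"
    by (subst measurable_cong[where g = "\<lambda>x. ereal (f x)"]) (auto simp: u)
  then show "(\<lambda>x. max (u x) 0) \<in> borel_measurable (lebesgue_on D)" by measurable
  show "u x < \<infinity>" if "x \<in> D" for x using u[OF that] by simp
  show "(\<integral>\<^sup>+x. e2ennreal \<bar>max (u x) 0\<bar> \<partial>lebesgue_on C) < \<infinity>" if C: "compact C \<and> C \<subseteq> D" for C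
  proof -
    have "compact (f ` C)"
      using C continuous_on_subset[OF cf] by (blast intro: compact_continuous_image)
    then obtain B where B: "\<And>y. y \<in> C \<Longrightarrow> \<bar>f y\<bar> \<le> B"
      using compact_imp_bounded bounded_iff by (metis imageI real_norm_def)
    have "(\<integral>\<^sup>+x. e2ennreal \<bar>max (u x) 0\<bar> \<partial>lebesgue_on C) \<le> (\<integral>\<^sup>+x. ennreal B \<partial>lebesgue_on C)"
    proof (rule nn_integral_mono)
      fix x assume "x \<in> space (lebesgue_on C)"
      then have x: "x \<in> C" by simp
      have "u x = ereal (f x)" using u x C by blast
      then have "e2ennreal \<bar>max (u x) 0\<bar> = ennreal (max (f x) 0)"
        by (simp only: e2ennreal_abs_max)
      also have "\<dots> \<le> ennreal B" using B[OF x] by (intro ennreal_leI) auto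
      finally show "e2ennreal \<bar>max (u x) 0\<bar> \<le> ennreal B" .
    qed
    also have "\<dots> = ennreal B * emeasure lebesgue C"
      using C by (simp add: emeasure_restrict_space lmeasurable_compact fmeasurableD)
    also have "\<dots> < \<infinity>"
      using lmeasurable_compact[of C] C by (auto simp: fmeasurable_def ennreal_mult_less_top)
    finally show ?thesis .
  qed
  fix x r assume xr: "0 < r \<and> cball x r \<subseteq> D"
  have x: "x \<in> D" using xr by auto
  have int: "integrable lborel (\<lambda>y. indicator (ball x r) y * f y)"
    by (rule integrable_indicator_bounded) (use continuous_on_subset[OF cf] xr in auto)
  then have int': "integrable (lebesgue_on (ball x r)) f"
    by (subst integrable_restrict_space) (auto simp: integrable_completion)
  have "integral\<^sup>L (lebesgue_on (ball x r)) f = (\<integral>y. indicator (ball x r) y * f y \<partial>lborel)"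
    using borel_measurable_integrable[OF int]
    by (subst integral_restrict_space) (auto simp: integral_completion)
  then have I: "integral\<^sup>L (lebesgue_on (ball x r)) f = f x * (measure lborel (ball (0::'a) 1) * r ^ DIM('a))"
    using mean xr by simp
  have "ereal_integral (lebesgue_on (ball x r)) u = ereal (f x * (measure lborel (ball (0::'a) 1) * r ^ DIM('a)))"
    unfolding I[symmetric]
  proof (rule ereal_integral_eq_integral[OF _ int'])
    fix y assume "y \<in> space (lebesgue_on (ball x r))"
    then have "y \<in> cball x r" by simp
    then show "u y = ereal (f y)" using u xr by blast
  qed
  then show "u x \<le> ereal (1 / (measure lebesgue (ball (0::'a) 1) * r ^ DIM('a))) * ereal_integral (lebesgue_on (ball x r)) u"
    using content_ball_pos[of 1 "0::'a"] xr u[OF x] by (simp add: measure_lebesgue_ball)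
qed

section \<open>Consequences of the two opposite inequalities\<close>

text \<open>The hypothesis on u controls only its positive part; the negative part of u is the
  positive part of \<open>- u\<close>, which the second hypothesis controls.\<close>

lemma quasinearly_subharmonic_ns_integrable:
  fixes f :: "'a::euclidean_space \<Rightarrow> real"
  assumes D: "open D" and u: "\<And>x. x \<in> D \<Longrightarrow> u x = ereal (f x)"
    and q: "quasinearly_subharmonic_ns K D u" "quasinearly_subharmonic_ns K D (\<lambda>x. - u x)"
    and C: "compact C" "C \<subseteq> D"
  shows "integrable (lebesgue_on C) f"
proof (rule integrableI_bounded)
  have Cm: "C \<in> sets lebesgue" using C by (simp add: lmeasurable_compact fmeasurableD)
  have um: "u \<in> borel_measurable (lebesgue_on D)" using q by (simp add: quasinearly_subharmonic_ns_def)
  have "(\<lambda>x. real_of_ereal (u x)) \<in> borel_measurable (lebesgue_on D)" using um by measurable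
  then have "f \<in> borel_measurable (lebesgue_on D)"
    by (subst measurable_cong[where g = "\<lambda>x. real_of_ereal (u x)"]) (auto simp: u)
  then show fm: "f \<in> borel_measurable (lebesgue_on C)"
    using C Cm by (auto intro: measurable_restrict_mono)
  have pm: "(\<lambda>x. ennreal (max (f x) 0)) \<in> borel_measurable (lebesgue_on C)" using fm by measurable
  have "(\<integral>\<^sup>+x. ennreal (norm (f x)) \<partial>lebesgue_on C)
      = (\<integral>\<^sup>+x. ennreal (max (f x) 0) + ennreal (max (- f x) 0) \<partial>lebesgue_on C)"
    by (rule nn_integral_cong) (auto simp: max_def simp flip: ennreal_plus)
  also have "\<dots> = (\<integral>\<^sup>+x. ennreal (max (f x) 0) \<partial>lebesgue_on C) + (\<integral>\<^sup>+x. ennreal (max (- f x) 0) \<partial>lebesgue_on C)"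
    by (rule nn_integral_add) (use fm in measurable)
  also have "(\<integral>\<^sup>+x. ennreal (max (f x) 0) \<partial>lebesgue_on C) = (\<integral>\<^sup>+x. e2ennreal \<bar>max (u x) 0\<bar> \<partial>lebesgue_on C)"
    using C(2) u e2ennreal_abs_max[of "f _"] by (intro nn_integral_cong) (simp add: subset_iff)
  also have "(\<integral>\<^sup>+x. ennreal (max (- f x) 0) \<partial>lebesgue_on C) = (\<integral>\<^sup>+x. e2ennreal \<bar>max (- u x) 0\<bar> \<partial>lebesgue_on C)"
    using C(2) u e2ennreal_abs_max[of "- f _"] by (intro nn_integral_cong) (simp add: subset_iff)
  also have "(\<integral>\<^sup>+x. e2ennreal \<bar>max (u x) 0\<bar> \<partial>lebesgue_on C) + (\<integral>\<^sup>+x. e2ennreal \<bar>max (- u x) 0\<bar> \<partial>lebesgue_on C) < \<infinity>"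
    using q C by (simp add: quasinearly_subharmonic_ns_def locally_integrable_on_def)
  finally show "(\<integral>\<^sup>+x. ennreal (norm (f x)) \<partial>lebesgue_on C) < \<infinity>" .
qed

text \<open>Integrability makes the integral of \<open>- u\<close> the exact negative of that of u,
  so the two inequalities become opposite. The factor K stays in the identity.\<close>

lemma quasinearly_subharmonic_ns_mean_value:
  fixes f :: "'a::euclidean_space \<Rightarrow> real"
  assumes D: "open D" and u: "\<And>x. x \<in> D \<Longrightarrow> u x = ereal (f x)"
    and q: "quasinearly_subharmonic_ns K D u" "quasinearly_subharmonic_ns K D (\<lambda>x. - u x)"
    and r: "0 < r" and sub: "cball x r \<subseteq> D"
  shows "K * integral\<^sup>L lebesgue (\<lambda>y. indicator (ball x r) y * f y) = f x * measure lborel (ball x r)"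
proof -
  define I where "I = integral\<^sup>L lebesgue (\<lambda>y. indicator (ball x r) y * f y)"
  define m where "m = measure lborel (ball x r)"
  have m: "m = measure lebesgue (ball (0::'a) 1) * r ^ DIM('a)" "m > 0"
    using content_ball_conv_unit_ball[of r x] content_ball_pos[OF r, of x] r
    by (auto simp: m_def measure_lebesgue_ball)
  have x: "x \<in> D" using sub r by auto
  have "integrable (lebesgue_on (cball x r)) f"
    by (rule quasinearly_subharmonic_ns_integrable[OF D u q compact_cball sub])
  then have "integrable lebesgue (\<lambda>y. indicator (cball x r) y *\<^sub>R f y)"
    by (subst (asm) integrable_restrict_space) auto
  then have "set_integrable lebesgue (ball x r) f"
    using set_integrable_subset[of lebesgue "cball x r" f "ball x r"] by (auto simp: set_integrable_def)
  then have int: "integrable (lebesgue_on (ball x r)) f"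
    by (subst integrable_restrict_space) (auto simp: set_integrable_def)
  have I: "integral\<^sup>L (lebesgue_on (ball x r)) f = I"
    unfolding I_def by (subst integral_restrict_space) auto
  have ub: "u y = ereal (f y)" if "y \<in> space (lebesgue_on (ball x r))" for y
  proof -
    have "y \<in> cball x r" using that by simp
    then show ?thesis using u sub by blast
  qed
  have "ereal_integral (lebesgue_on (ball x r)) u = ereal I"
    using ereal_integral_eq_integral[OF ub int] by (simp add: I)
  moreover have "u x \<le> ereal (K / m) * ereal_integral (lebesgue_on (ball x r)) u"
    using q(1) r sub unfolding quasinearly_subharmonic_ns_def m by blast
  ultimately have 1: "f x \<le> K / m * I" using u[OF x] by simp
  have "ereal_integral (lebesgue_on (ball x r)) (\<lambda>y. - u y) = ereal (- I)"
    using ereal_integral_eq_integral[of "lebesgue_on (ball x r)" "\<lambda>y. - u y" "\<lambda>y. - f y"] ub int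
    by (simp add: I)
  moreover have "- u x \<le> ereal (K / m) * ereal_integral (lebesgue_on (ball x r)) (\<lambda>y. - u y)"
    using q(2) r sub unfolding quasinearly_subharmonic_ns_def m by blast
  ultimately have 2: "- f x \<le> K / m * (- I)" using u[OF x] by simp
  from 1 2 have "f x = K / m * I" by simp
  then show ?thesis using m(2) by (simp add: I_def[symmetric] m_def[symmetric])
qed

lemma quasinearly_subharmonic_ns_imp_harmonic:
  fixes f :: "'a::euclidean_space \<Rightarrow> real"
  assumes D: "open D" and u: "\<And>x. x \<in> D \<Longrightarrow> u x = ereal (f x)"
    and q: "quasinearly_subharmonic_ns K D u" "quasinearly_subharmonic_ns K D (\<lambda>x. - u x)"
  shows "harmonic_fun_on D f"
proof (rule harmonic_fun_on_local)
  fix x0 assume "x0 \<in> D"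
  then obtain e where e: "0 < e" "cball x0 e \<subseteq> D" using D open_contains_cball by blast
  \<comment> \<open>The cut-off makes the function integrable over the whole space.\<close>
  define g where "g y = indicator (cball x0 e) y * f y" for y
  have "integrable (lebesgue_on (cball x0 e)) f"
    by (rule quasinearly_subharmonic_ns_integrable[OF D u q compact_cball e(2)])
  then have g: "integrable lebesgue g"
    unfolding g_def by (subst (asm) integrable_restrict_space) auto
  \<comment> \<open>The kernel lemmas concern Borel functions and \<open>lborel\<close>. Passing to
    an almost everywhere equal Borel version leaves the ball integrals unchanged.\<close>
  obtain w where w: "w \<in> borel_measurable lborel" "AE y in lborel. g y = w y"
    using completion_ex_borel_measurable_real[OF borel_measurable_integrable[OF g]] by blast
  have gw: "AE y in lebesgue. g y = w y" using w(2) by (rule AE_completion)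
  have wm: "w \<in> borel_measurable lebesgue" using w(1) by (rule measurable_completion)
  have "integrable lebesgue w"
    using g gw wm by (subst integrable_cong_AE[where g = g]) (auto dest: borel_measurable_integrable)
  then have wi: "integrable lborel w" using w(1) by (simp add: integrable_completion)
  have "harmonic_fun_on (ball x0 (e / 2)) f"
  \<comment> \<open>With centre in the half ball and radius at most \<open>e / 2\<close>, every ball
    stays in \<open>cball x0 e\<close>, where the cut-off is invisible. Here K is absorbed into the
    averaged function.\<close>
  proof (rule mean_value_imp_harmonic[where w = "\<lambda>y. K * w y" and R = "e / 2"])
    fix x r assume x: "x \<in> ball x0 (e / 2)" and r: "0 < r" "r \<le> e / 2"
    have sub: "cball x r \<subseteq> cball x0 e"
    proof
      fix y assume "y \<in> cball x r"
      then show "y \<in> cball x0 e" using x r dist_triangle[of x0 y x] by simp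
    qed
    have bm: "(\<lambda>y. indicator (ball x r) y * w y) \<in> borel_measurable lborel"
      using w(1) by (intro borel_measurable_times borel_measurable_indicator) auto
    have "(\<integral>y. indicator (ball x r) y * w y \<partial>lborel) = (\<integral>y. indicator (ball x r) y * w y \<partial>lebesgue)"
      by (rule integral_completion[OF bm, symmetric])
    also have "\<dots> = (\<integral>y. indicator (ball x r) y * g y \<partial>lebesgue)"
    proof (rule integral_cong_AE)
      show "(\<lambda>y. indicator (ball x r) y * w y) \<in> borel_measurable lebesgue"
        using bm by (rule measurable_completion)
      have "indicator (ball x r) \<in> borel_measurable lebesgue"
        by (rule borel_measurable_indicator) simp
      then show "(\<lambda>y. indicator (ball x r) y * g y) \<in> borel_measurable lebesgue"
        using borel_measurable_integrable[OF g] by (intro borel_measurable_times)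
      show "AE y in lebesgue. indicator (ball x r) y * w y = indicator (ball x r) y * g y"
        using gw by eventually_elim simp
    qed
    also have "(\<lambda>y. indicator (ball x r) y * g y) = (\<lambda>y. indicator (ball x r) y * f y)"
    proof
      fix y
      have "y \<in> cball x0 e" if "y \<in> ball x r" using that sub by force
      then show "indicator (ball x r) y * g y = indicator (ball x r) y * f y"
        by (auto simp: g_def indicator_def)
    qed
    finally have "(\<integral>y. indicator (ball x r) y * (K * w y) \<partial>lborel)
        = K * (\<integral>y. indicator (ball x r) y * f y \<partial>lebesgue)"
      by (simp add: mult.left_commute)
    then show "(\<integral>y. indicator (ball x r) y * (K * w y) \<partial>lborel) = f x * measure lborel (ball x r)"
      using quasinearly_subharmonic_ns_mean_value[OF D u q r(1)] sub e(2) by simp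
  qed (use wi e in auto)
  then show "\<exists>S. open S \<and> x0 \<in> S \<and> harmonic_fun_on S f"
    using e by (intro exI[of _ "ball x0 (e / 2)"]) simp
qed

theorem proposition4:
  fixes D :: "(real ^ 'n) set" and u :: "real ^ 'n \<Rightarrow> ereal"
  assumes "CARD('n) \<ge> 2"
    and "open D" and "connected D" and "D \<noteq> {}"
    and "\<And>x. x \<in> D \<Longrightarrow> u x < \<infinity>"
  shows "harmonic_ereal_on D u \<longleftrightarrow>
    (\<exists>K\<ge>1. quasinearly_subharmonic_ns K D u \<and> quasinearly_subharmonic_ns K D (\<lambda>x. - u x))"
proof
  define f where "f x = real_of_ereal (u x)" for x
  note D = \<open>open D\<close>
  {
    assume "harmonic_ereal_on D u"
    then have u: "\<And>x. x \<in> D \<Longrightarrow> u x = ereal (f x)" and f: "harmonic_fun_on D f"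
      by (auto simp: harmonic_ereal_on_def f_def[abs_def] ereal_real)
    have cf: "continuous_on D f"
      using f D by (auto simp: harmonic_fun_on_def C2_fun_on_def intro: C1_fun_on_continuous_on)
    note mean = harmonic_imp_mean_value[OF f D]
    have "quasinearly_subharmonic_ns 1 D u"
      by (rule mean_value_imp_quasinearly_subharmonic_ns[OF D cf u mean])
    moreover have "quasinearly_subharmonic_ns 1 D (\<lambda>x. - u x)"
    proof (rule mean_value_imp_quasinearly_subharmonic_ns[OF D])
      show "continuous_on D (\<lambda>x. - f x)" using cf by (rule continuous_on_minus)
    qed (use u mean in auto)
    ultimately show "\<exists>K\<ge>1. quasinearly_subharmonic_ns K D u \<and> quasinearly_subharmonic_ns K D (\<lambda>x. - u x)"
      by (intro exI[of _ 1]) simp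
  }
  assume "\<exists>K\<ge>1. quasinearly_subharmonic_ns K D u \<and> quasinearly_subharmonic_ns K D (\<lambda>x. - u x)"
  then obtain K where q: "quasinearly_subharmonic_ns K D u" "quasinearly_subharmonic_ns K D (\<lambda>x. - u x)"
    by blast
  \<comment> \<open>At a point with value \<open>-\<infinity>\<close> the function
    \<open>- u\<close> would be \<open>\<infinity>\<close>, which the hypothesis on
    \<open>- u\<close> excludes.\<close>
  have fin: "\<bar>u x\<bar> \<noteq> \<infinity>" if "x \<in> D" for x
  proof -
    have "u x < \<infinity>" "- u x < \<infinity>" using q that by (auto simp: quasinearly_subharmonic_ns_def)
    then show ?thesis by (cases "u x") auto
  qed
  have "harmonic_fun_on D f"
    by (rule quasinearly_subharmonic_ns_imp_harmonic[OF D _ q]) (use fin in \<open>simp add: f_def ereal_real\<close>)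
  then show "harmonic_ereal_on D u"
    using fin by (simp add: harmonic_ereal_on_def f_def[abs_def])
qed

end
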